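(* Consider a quantum spin system on the $\nu$-dimensional hypercubic lattice $\Lambda$ of side length $L$ ($N=L^\nu$ sites, finite-dimensional single-site Hilbert space). For $i=0,\dots,m-1$ let $\hat X_{N(i)}=\sum_j\gamma_j(\hat o_{(i)})$ with $\gamma_j$ the lattice translation by $j$ and $\hat o_{(i)}$ an $N$-independent self-adjoint observable of finite support, and $\hat x_{N(i)}=\hat X_{N(i)}/N$. Let $\eta$ be an $N$-independent polynomial with real coefficients in $m$ noncommutative indeterminates with $\eta(\hat{\boldsymbol x}_N)$ self-adjoint for all $N$, $\hat\rho_N^\eta=e^{-N\eta(\hat{\boldsymbol x}_N)}/\mathrm{Tr}[e^{-N\eta(\hat{\boldsymbol x}_N)}]$, $x_{N(i)}^\eta=\mathrm{Tr}[\hat x_{N(i)}\hat\rho_N^\eta]$, and assume $x_{(i)}^\eta=\lim_{N\to\infty}x_{N(i)}^\eta$ exists. Let $\Pi_{(i)}^\eta=\lim_{N\to\infty}\frac{\partial\eta}{\partial x_{(i)}}(\boldsymbol x_N^\eta)$, $\hat\Gamma_N=\sum_i\Pi^\eta_{(i)}\hat X_{N(i)}$, and $\hat A(\tau)=e^{i\hat\Gamma_N\tau}\hat Ae^{-i\hat\Gamma_N\tau}$. Let $C,\mu,v>0$ be Lieb–Robinson constants for $\hat\Gamma_N$, i.e. $N$-independent constants such that for all observables $\hat A,\hat B$ with finite supports $U,V\subset\Lambda$ and all $\tau\in\mathbb{R}$, $\|[\hat A(\tau),\hat B]\|\le C\|\hat A\|\|\hat B\|\min[|U|,|V|]e^{-\mu(d(U,V)-v|\tau|)}$.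 Assume: (i) for every $i$, $\mathrm{Tr}[(\hat x_{N(i)}-x^\eta_{N(i)})^2\hat\rho_N^\eta]=O(N^{-1})$; (ii) for every $i$, $x^\eta_{N(i)}=x^\eta_{(i)}+O(N^{-1/2})$. Then for every observable $\hat A$ with finite support $U\subset\Lambda$, \[\frac{d}{d\tau}\mathrm{Tr}[\hat A(\tau)\hat\rho_N^\eta]=\begin{cases}O\big((L^{-1/2}\log L)^\nu\big)&(v|\tau|\lesssim\log L),\\ O\big((L^{-1/2}|\tau|)^\nu\big)&(\log L\ll v|\tau|\ll L).\end{cases}\]
   Context: $\partial\eta/\partial x_{(i)}$ denotes the partial derivative of the real function on $\mathbb{R}^m$ obtained by substituting commuting real variables into $\eta$. $d(U,V)$ is the lattice (shortest path) distance between sets. The Lieb–Robinson bound holds for such finite-range translation-invariant $\hat\Gamma_N$. *)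

theory Defs
  imports "HOL-Analysis.Analysis"
begin

text \<open>Operators on a finite-dimensional tensor-product Hilbert space are represented
 as matrices indexed by configurations: a configuration assigns to every site a local
 basis index < d (and 0 off the site set). 's is the site type.\<close>

type_synonym 's op = "('s \<Rightarrow> nat) \<Rightarrow> ('s \<Rightarrow> nat) \<Rightarrow> complex"

definition cfgs :: "nat \<Rightarrow> 's set \<Rightarrow> ('s \<Rightarrow> nat) set" where
  "cfgs d U = {\<sigma>. (\<forall>x\<in>U. \<sigma> x < d) \<and> (\<forall>x. x \<notin> U \<longrightarrow> \<sigma> x = 0)}"

definition rst :: "'s set \<Rightarrow> ('s \<Rightarrow> nat) \<Rightarrow> ('s \<Rightarrow> nat)" where
  "rst U \<sigma> = (\<lambda>x. if x \<in> U then \<sigma> x else 0)"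

definition lattice :: "nat \<Rightarrow> ('n::finite \<Rightarrow> nat) set" where
  "lattice L = {x. \<forall>k. x k < L}"

definition Sp :: "nat \<Rightarrow> nat \<Rightarrow> (('n::finite \<Rightarrow> nat) \<Rightarrow> nat) set" where
  "Sp d L = cfgs d (lattice L)"

definition mmul :: "('s \<Rightarrow> nat) set \<Rightarrow> 's op \<Rightarrow> 's op \<Rightarrow> 's op" where
  "mmul S A B = (\<lambda>\<sigma> \<tau>. \<Sum>\<kappa>\<in>S. A \<sigma> \<kappa> * B \<kappa> \<tau>)"

definition mid :: "'s op" where
  "mid = (\<lambda>\<sigma> \<tau>. if \<sigma> = \<tau> then 1 else 0)"

definition msc :: "complex \<Rightarrow> 's op \<Rightarrow> 's op" where
  "msc a A = (\<lambda>\<sigma> \<tau>. a * A \<sigma> \<tau>)"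

definition msub :: "'s op \<Rightarrow> 's op \<Rightarrow> 's op" where
  "msub A B = (\<lambda>\<sigma> \<tau>. A \<sigma> \<tau> - B \<sigma> \<tau>)"

definition mcomm :: "('s \<Rightarrow> nat) set \<Rightarrow> 's op \<Rightarrow> 's op \<Rightarrow> 's op" where
  "mcomm S A B = msub (mmul S A B) (mmul S B A)"

primrec mpow :: "('s \<Rightarrow> nat) set \<Rightarrow> 's op \<Rightarrow> nat \<Rightarrow> 's op" where
  "mpow S A 0 = mid"
| "mpow S A (Suc k) = mmul S A (mpow S A k)"

definition mexp :: "('s \<Rightarrow> nat) set \<Rightarrow> 's op \<Rightarrow> 's op" where
  "mexp S A = (\<lambda>\<sigma> \<tau>. \<Sum>k. mpow S A k \<sigma> \<tau> / of_nat (fact k))"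

definition mtr :: "('s \<Rightarrow> nat) set \<Rightarrow> 's op \<Rightarrow> complex" where
  "mtr S A = (\<Sum>\<sigma>\<in>S. A \<sigma> \<sigma>)"

definition herm :: "('s \<Rightarrow> nat) set \<Rightarrow> 's op \<Rightarrow> bool" where
  "herm S A = (\<forall>\<sigma>\<in>S. \<forall>\<tau>\<in>S. A \<sigma> \<tau> = cnj (A \<tau> \<sigma>))"

definition vnorm :: "('s \<Rightarrow> nat) set \<Rightarrow> (('s \<Rightarrow> nat) \<Rightarrow> complex) \<Rightarrow> real" where
  "vnorm S w = sqrt (\<Sum>\<sigma>\<in>S. (cmod (w \<sigma>))\<^sup>2)"

definition opnorm :: "('s \<Rightarrow> nat) set \<Rightarrow> 's op \<Rightarrow> real" where
  "opnorm S A = Sup {vnorm S (\<lambda>\<sigma>. \<Sum>\<kappa>\<in>S. A \<sigma> \<kappa> * w \<kappa>) | w. vnorm S w \<le> 1}"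

definition evol :: "('s \<Rightarrow> nat) set \<Rightarrow> 's op \<Rightarrow> 's op \<Rightarrow> real \<Rightarrow> 's op" where
  "evol S G A t = mmul S (mmul S (mexp S (msc (\<i> * complex_of_real t) G)) A)
                        (mexp S (msc (- \<i> * complex_of_real t) G))"

text \<open>An operator on the lattice-L system has support in U (a subset of the lattice):
 it is of the form a \<otimes> identity, a acting on the sites of U.\<close>
definition supported_in :: "nat \<Rightarrow> nat \<Rightarrow> ('n::finite \<Rightarrow> nat) set \<Rightarrow> ('n \<Rightarrow> nat) op \<Rightarrow> bool" where
  "supported_in d L U A = (\<exists>a. \<forall>\<sigma>\<in>Sp d L. \<forall>\<tau>\<in>Sp d L.
      A \<sigma> \<tau> = (if (\<forall>x\<in>lattice L - U. \<sigma> x = \<tau> x) then a (rst U \<sigma>) (rst U \<tau>) else 0))"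

definition tdist :: "nat \<Rightarrow> ('n::finite \<Rightarrow> nat) \<Rightarrow> ('n \<Rightarrow> nat) \<Rightarrow> nat" where
  "tdist L x y = (\<Sum>k\<in>UNIV. min (nat \<bar>int (x k) - int (y k)\<bar>) (L - nat \<bar>int (x k) - int (y k)\<bar>))"

definition setdist :: "nat \<Rightarrow> ('n::finite \<Rightarrow> nat) set \<Rightarrow> ('n \<Rightarrow> nat) set \<Rightarrow> real" where
  "setdist L U V = real (Min {tdist L x y | x y. x \<in> U \<and> y \<in> V})"

text \<open>N-independent local operators live on finite subsets of Z^nu; they are placed
 on the periodic lattice, translated by j (the translation gamma_j).\<close>
definition tor :: "nat \<Rightarrow> ('n \<Rightarrow> int) \<Rightarrow> ('n \<Rightarrow> nat)" where
  "tor L u = (\<lambda>k. nat (u k mod int L))"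

definition shift_site :: "nat \<Rightarrow> ('n \<Rightarrow> nat) \<Rightarrow> ('n \<Rightarrow> int) \<Rightarrow> ('n \<Rightarrow> nat)" where
  "shift_site L j u = tor L (\<lambda>k. u k + int (j k))"

definition embed :: "nat \<Rightarrow> ('n::finite \<Rightarrow> nat) \<Rightarrow> ('n \<Rightarrow> int) set \<Rightarrow> ('n \<Rightarrow> int) op
                      \<Rightarrow> ('n \<Rightarrow> nat) op" where
  "embed L j U a = (\<lambda>\<sigma> \<tau>.
     if (\<forall>x\<in>lattice L - shift_site L j ` U. \<sigma> x = \<tau> x)
     then a (\<lambda>u. if u \<in> U then \<sigma> (shift_site L j u) else 0)
            (\<lambda>u. if u \<in> U then \<tau> (shift_site L j u) else 0)
     else 0)"

definition Xop :: "nat \<Rightarrow> ('n::finite \<Rightarrow> int) set \<Rightarrow> ('n \<Rightarrow> int) op \<Rightarrow> ('n \<Rightarrow> nat) op" where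
  "Xop L U a = (\<lambda>\<sigma> \<tau>. \<Sum>j\<in>lattice L. embed L j U a \<sigma> \<tau>)"

definition xhat :: "nat \<Rightarrow> ('n::finite \<Rightarrow> int) set \<Rightarrow> ('n \<Rightarrow> int) op \<Rightarrow> ('n \<Rightarrow> nat) op" where
  "xhat L U a = msc (complex_of_real (1 / real L ^ CARD('n))) (Xop L U a)"

text \<open>Polynomials in noncommuting indeterminates x_0..x_{m-1} with real coefficients:
 a finitely supported coefficient function on words (lists of indices); the word
 [i1,...,ik] stands for the monomial x_{i1} x_{i2} ... x_{ik}.\<close>
definition ncev :: "('s \<Rightarrow> nat) set \<Rightarrow> (nat list \<Rightarrow> real) \<Rightarrow> (nat \<Rightarrow> 's op) \<Rightarrow> 's op" where
  "ncev S c xs = (\<lambda>\<sigma> \<tau>. \<Sum>w\<in>{w. c w \<noteq> 0}.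
       complex_of_real (c w) * foldr (mmul S) (map xs w) mid \<sigma> \<tau>)"

definition cev :: "(nat list \<Rightarrow> real) \<Rightarrow> (nat \<Rightarrow> real) \<Rightarrow> real" where
  "cev c y = (\<Sum>w\<in>{w. c w \<noteq> 0}. c w * prod_list (map y w))"

definition pdiff :: "(nat list \<Rightarrow> real) \<Rightarrow> nat \<Rightarrow> (nat \<Rightarrow> real) \<Rightarrow> real" where
  "pdiff c i y = deriv (\<lambda>t. cev c (y(i := t))) (y i)"

definition etaN :: "nat \<Rightarrow> (nat list \<Rightarrow> real) \<Rightarrow> (nat \<Rightarrow> ('n::finite \<Rightarrow> int) set)
                    \<Rightarrow> (nat \<Rightarrow> ('n \<Rightarrow> int) op) \<Rightarrow> nat \<Rightarrow> ('n \<Rightarrow> nat) op" where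
  "etaN d c Uo ao L = ncev (Sp d L) c (\<lambda>i. xhat L (Uo i) (ao i))"

definition rhoN :: "nat \<Rightarrow> (nat list \<Rightarrow> real) \<Rightarrow> (nat \<Rightarrow> ('n::finite \<Rightarrow> int) set)
                    \<Rightarrow> (nat \<Rightarrow> ('n \<Rightarrow> int) op) \<Rightarrow> nat \<Rightarrow> ('n \<Rightarrow> nat) op" where
  "rhoN d c Uo ao L =
     (let E = mexp (Sp d L) (msc (- complex_of_real (real L ^ CARD('n))) (etaN d c Uo ao L))
      in msc (1 / mtr (Sp d L) E) E)"

definition xN :: "nat \<Rightarrow> (nat list \<Rightarrow> real) \<Rightarrow> (nat \<Rightarrow> ('n::finite \<Rightarrow> int) set)
                    \<Rightarrow> (nat \<Rightarrow> ('n \<Rightarrow> int) op) \<Rightarrow> nat \<Rightarrow> nat \<Rightarrow> real" where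
  "xN d c Uo ao L i = Re (mtr (Sp d L) (mmul (Sp d L) (xhat L (Uo i) (ao i)) (rhoN d c Uo ao L)))"

definition varN :: "nat \<Rightarrow> (nat list \<Rightarrow> real) \<Rightarrow> (nat \<Rightarrow> ('n::finite \<Rightarrow> int) set)
                    \<Rightarrow> (nat \<Rightarrow> ('n \<Rightarrow> int) op) \<Rightarrow> nat \<Rightarrow> nat \<Rightarrow> complex" where
  "varN d c Uo ao L i =
     (let S = Sp d L; D = msub (xhat L (Uo i) (ao i)) (msc (complex_of_real (xN d c Uo ao L i)) mid)
      in mtr S (mmul S (mmul S D D) (rhoN d c Uo ao L)))"

definition GamN :: "nat \<Rightarrow> (nat \<Rightarrow> real) \<Rightarrow> (nat \<Rightarrow> ('n::finite \<Rightarrow> int) set)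
                    \<Rightarrow> (nat \<Rightarrow> ('n \<Rightarrow> int) op) \<Rightarrow> nat \<Rightarrow> ('n \<Rightarrow> nat) op" where
  "GamN m Pv Uo ao L = (\<lambda>\<sigma> \<tau>. \<Sum>i<m. complex_of_real (Pv i) * Xop L (Uo i) (ao i) \<sigma> \<tau>)"

end

theory Submission
  imports Defs
begin

text \<open>Since \<open>\<rho>\<close> commutes with \<open>N \<eta>\<close>, the derivative equals \<open>-\<i> Tr([B, \<Gamma> - N \<eta>] \<rho>)\<close> with
  \<open>B = A(\<tau>)\<close>. Expand \<open>[B, \<eta>]\<close> by the Leibniz rule into products containing one commutator
  \<open>[B, x\<^sub>i]\<close>, and replace the other factors one at a time by their expectation values, always the
  factor standing next to \<open>\<rho>\<close> on the left or on the right. Writing \<open>\<rho> = F\<^sup>2\<close> and using the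
  Cauchy--Schwarz inequality for the Hilbert--Schmidt norm, each replacement costs at most a standard
  deviation, which is \<open>O(N\<^sup>-\<^sup>1\<^sup>/\<^sup>2)\<close>, times the norm of the remaining operators. What is left is
  \<open>\<Gamma>\<close> up to an error of order \<open>N\<^sup>-\<^sup>1\<^sup>/\<^sup>2\<close> in its coefficients. Hence the derivative is
  \<open>O(N\<^sup>-\<^sup>1\<^sup>/\<^sup>2)\<close> times the norms of the commutators of \<open>A(\<tau>)\<close> with the extensive observables, and these
  are \<open>O((1 + v \<bar>\<tau>\<bar>)\<^sup>\<nu>)\<close> because by the Lieb--Robinson bound only the sites within distance
  about \<open>v \<bar>\<tau>\<bar>\<close> of the support of \<open>A\<close> matter.\<close>

section \<open>Matrices on a finite index set\<close>

text \<open>The scales have to match: the generator carries a factor N, each commutator of the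
  evolved observable with a density carries 1/N, so one standard deviation remains as the net size.
  Inside a product such as x_1 [B, x_2] x_3 \<rho> only the outermost factors can be centred: there
  a deviation D meets F, and D F has a Hilbert-Schmidt norm proportional to the standard deviation.
  Working inwards from both ends avoids any estimate of commutators between the densities. The
  coefficients are a second obstacle: \<open>Pv\<close> is given only as a limit along the mean
  values, while a rate is needed. Continuity of the polynomial identifies it with the derivative at
  \<open>xlim\<close>, and a Lipschitz estimate on a bounded box converts assumption (ii) into that
  rate. Operators are functions on all configurations, but identities involving \<open>mid\<close>
  or exponentials are needed only for indices in the finite set S; hence the many congruence
  lemmas.\<close>

definition mvec :: "('s \<Rightarrow> nat) set \<Rightarrow> 's op \<Rightarrow> (('s \<Rightarrow> nat) \<Rightarrow> complex) \<Rightarrow> (('s \<Rightarrow> nat) \<Rightarrow> complex)" where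
  "mvec S A w = (\<lambda>\<sigma>. \<Sum>\<kappa>\<in>S. A \<sigma> \<kappa> * w \<kappa>)"

text \<open>A relation in place of the supremum \<open>opnorm\<close>: bounds then add and multiply
  without first showing that a supremum is finite. \<open>opnorm_le\<close> and
  \<open>op_bound_opnorm\<close> translate between the two.\<close>

definition op_bound :: "('s \<Rightarrow> nat) set \<Rightarrow> 's op \<Rightarrow> real \<Rightarrow> bool" where
  "op_bound S A K \<longleftrightarrow> 0 \<le> K \<and> (\<forall>w. vnorm S (mvec S A w) \<le> K * vnorm S w)"

definition hs_norm :: "('s \<Rightarrow> nat) set \<Rightarrow> 's op \<Rightarrow> real" where
  "hs_norm S A = L2_set (\<lambda>(\<sigma>, \<tau>). cmod (A \<sigma> \<tau>)) (S \<times> S)"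

lemma vnorm_L2: "vnorm S w = L2_set (\<lambda>\<sigma>. cmod (w \<sigma>)) S"
  by (simp add: vnorm_def L2_set_def)

lemma vnorm_nonneg: "0 \<le> vnorm S w"
  by (simp add: vnorm_L2 L2_set_nonneg)

lemma vnorm_cong: "(\<And>\<sigma>. \<sigma> \<in> S \<Longrightarrow> w \<sigma> = w' \<sigma>) \<Longrightarrow> vnorm S w = vnorm S w'"
  by (simp add: vnorm_def)

lemma vnorm_scale: "vnorm S (\<lambda>\<sigma>. a * w \<sigma>) = cmod a * vnorm S w"
  by (simp add: vnorm_L2 norm_mult L2_set_right_distrib)

lemma vnorm_triangle: "vnorm S (\<lambda>\<sigma>. w \<sigma> + w' \<sigma>) \<le> vnorm S w + vnorm S w'"
proof -
  have "vnorm S (\<lambda>\<sigma>. w \<sigma> + w' \<sigma>) \<le> L2_set (\<lambda>\<sigma>. cmod (w \<sigma>) + cmod (w' \<sigma>)) S"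
    unfolding vnorm_L2 by (intro L2_set_mono) (auto simp: norm_triangle_ineq)
  also have "\<dots> \<le> vnorm S w + vnorm S w'"
    unfolding vnorm_L2 by (rule L2_set_triangle_ineq)
  finally show ?thesis .
qed

section \<open>Algebra of products, traces and commutators\<close>

lemma mmul_assoc: "mmul S (mmul S A B) C = mmul S A (mmul S B C)"
proof (intro ext)
  fix \<sigma> \<tau>
  have "mmul S (mmul S A B) C \<sigma> \<tau> = (\<Sum>\<kappa>\<in>S. \<Sum>l\<in>S. A \<sigma> l * B l \<kappa> * C \<kappa> \<tau>)"
    by (simp add: mmul_def sum_distrib_right)
  also have "\<dots> = (\<Sum>l\<in>S. \<Sum>\<kappa>\<in>S. A \<sigma> l * B l \<kappa> * C \<kappa> \<tau>)"
    by (rule sum.swap)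
  also have "\<dots> = mmul S A (mmul S B C) \<sigma> \<tau>"
    by (simp add: mmul_def sum_distrib_left mult.assoc)
  finally show "mmul S (mmul S A B) C \<sigma> \<tau> = mmul S A (mmul S B C) \<sigma> \<tau>" .
qed

lemma mmul_cong:
  assumes "\<And>\<kappa>. \<kappa> \<in> S \<Longrightarrow> A \<sigma> \<kappa> = A' \<sigma> \<kappa>" "\<And>\<kappa>. \<kappa> \<in> S \<Longrightarrow> B \<kappa> \<tau> = B' \<kappa> \<tau>"
  shows "mmul S A B \<sigma> \<tau> = mmul S A' B' \<sigma> \<tau>"
  using assms by (simp add: mmul_def)

lemma mtr_cong: "(\<And>\<sigma>. \<sigma> \<in> S \<Longrightarrow> A \<sigma> \<sigma> = B \<sigma> \<sigma>) \<Longrightarrow> mtr S A = mtr S B"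
  by (simp add: mtr_def)

lemma mtr_mmul_cong:
  assumes "\<And>\<sigma> \<tau>. \<sigma> \<in> S \<Longrightarrow> \<tau> \<in> S \<Longrightarrow> A \<sigma> \<tau> = A' \<sigma> \<tau>"
    and "\<And>\<sigma> \<tau>. \<sigma> \<in> S \<Longrightarrow> \<tau> \<in> S \<Longrightarrow> B \<sigma> \<tau> = B' \<sigma> \<tau>"
  shows "mtr S (mmul S A B) = mtr S (mmul S A' B')"
  using assms by (intro mtr_cong mmul_cong) auto

lemma mtr_cyclic: "mtr S (mmul S A B) = mtr S (mmul S B A)"
  unfolding mtr_def mmul_def by (subst sum.swap) (simp add: mult.commute)

lemma mmul_msub_left: "mmul S (msub A B) C = msub (mmul S A C) (mmul S B C)"
  by (simp add: mmul_def msub_def fun_eq_iff left_diff_distrib sum_subtractf)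

lemma mmul_msub_right: "mmul S C (msub A B) = msub (mmul S C A) (mmul S C B)"
  by (simp add: mmul_def msub_def fun_eq_iff right_diff_distrib sum_subtractf)

lemma mmul_msc_left: "mmul S (msc a A) B = msc a (mmul S A B)"
  by (simp add: mmul_def msc_def fun_eq_iff sum_distrib_left mult.assoc)

lemma mmul_msc_right: "mmul S A (msc a B) = msc a (mmul S A B)"
  by (simp add: mmul_def msc_def fun_eq_iff sum_distrib_left mult_ac)

lemma mtr_msub: "mtr S (msub A B) = mtr S A - mtr S B"
  by (simp add: mtr_def msub_def sum_subtractf)

lemma mtr_msc: "mtr S (msc a A) = a * mtr S A"
  by (simp add: mtr_def msc_def sum_distrib_left)

lemma mcomm_mmul: "mcomm S B (mmul S x y) \<sigma> \<tau> = mmul S (mcomm S B x) y \<sigma> \<tau> + mmul S x (mcomm S B y) \<sigma> \<tau>"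
  unfolding mcomm_def mmul_msub_left mmul_msub_right by (simp add: mmul_assoc msub_def)

lemma mcomm_sum: "mcomm S B (\<lambda>\<sigma> \<tau>. \<Sum>j\<in>J. f j \<sigma> \<tau>) = (\<lambda>\<sigma> \<tau>. \<Sum>j\<in>J. mcomm S B (f j) \<sigma> \<tau>)"
  unfolding mcomm_def msub_def mmul_def
  by (auto simp: fun_eq_iff sum_distrib_left sum_distrib_right sum_subtractf intro!: arg_cong2[where f = "(-)"] sum.swap)

lemma mcomm_msc: "mcomm S B (msc a x) = msc a (mcomm S B x)"
  unfolding mcomm_def mmul_msc_left mmul_msc_right by (simp add: msub_def msc_def right_diff_distrib)

lemma mtr_mmul_sum: "mtr S (mmul S (\<lambda>\<sigma> \<tau>. \<Sum>j\<in>J. f j \<sigma> \<tau>) R) = (\<Sum>j\<in>J. mtr S (mmul S (f j) R))"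
  unfolding mtr_def mmul_def sum_distrib_right
  by (subst sum.swap[where A = J], intro sum.cong refl sum.swap)

lemma mvec_mmul: "mvec S (mmul S A B) w = mvec S A (mvec S B w)"
proof (intro ext)
  fix \<sigma>
  have "mvec S (mmul S A B) w \<sigma> = (\<Sum>\<kappa>\<in>S. \<Sum>l\<in>S. A \<sigma> l * B l \<kappa> * w \<kappa>)"
    by (simp add: mvec_def mmul_def sum_distrib_right)
  also have "\<dots> = (\<Sum>l\<in>S. \<Sum>\<kappa>\<in>S. A \<sigma> l * B l \<kappa> * w \<kappa>)"
    by (rule sum.swap)
  also have "\<dots> = mvec S A (mvec S B w) \<sigma>"
    by (simp add: mvec_def sum_distrib_left mult.assoc)
  finally show "mvec S (mmul S A B) w \<sigma> = mvec S A (mvec S B w) \<sigma>" .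
qed

section \<open>Operator bounds\<close>

lemma op_bound_cong:
  assumes "\<And>\<sigma> \<tau>. \<sigma> \<in> S \<Longrightarrow> \<tau> \<in> S \<Longrightarrow> A \<sigma> \<tau> = B \<sigma> \<tau>" "op_bound S A K"
  shows "op_bound S B K"
proof -
  have "vnorm S (mvec S B w) = vnorm S (mvec S A w)" for w
    using assms(1) by (intro vnorm_cong) (simp add: mvec_def)
  then show ?thesis using assms(2) by (simp add: op_bound_def)
qed

lemma op_bound_nonneg: "op_bound S A K \<Longrightarrow> 0 \<le> K"
  by (simp add: op_bound_def)

lemma op_bound_mono: "op_bound S A K \<Longrightarrow> K \<le> K' \<Longrightarrow> op_bound S A K'"
  unfolding op_bound_def by (meson mult_right_mono order.trans vnorm_nonneg)

lemma op_bound_add: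
  assumes "op_bound S A K" "op_bound S B K'"
  shows "op_bound S (\<lambda>\<sigma> \<tau>. A \<sigma> \<tau> + B \<sigma> \<tau>) (K + K')"
proof -
  have "vnorm S (mvec S (\<lambda>\<sigma> \<tau>. A \<sigma> \<tau> + B \<sigma> \<tau>) w) \<le> vnorm S (mvec S A w) + vnorm S (mvec S B w)" for w
    using vnorm_triangle[of S "mvec S A w" "mvec S B w"]
    by (simp add: mvec_def distrib_right sum.distrib)
  then show ?thesis
    using assms unfolding op_bound_def by (smt (verit) distrib_right)
qed

lemma op_bound_msc:
  assumes "op_bound S A K"
  shows "op_bound S (msc a A) (cmod a * K)"
proof -
  have "mvec S (msc a A) w = (\<lambda>\<sigma>. a * mvec S A w \<sigma>)" for w
    by (simp add: mvec_def msc_def sum_distrib_left mult.assoc)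
  then show ?thesis
    using assms by (simp add: op_bound_def vnorm_scale mult.assoc mult_left_mono)
qed

lemma op_bound_msub:
  assumes "op_bound S A K" "op_bound S B K'"
  shows "op_bound S (msub A B) (K + K')"
  using op_bound_add[OF assms(1) op_bound_msc[OF assms(2), of "-1"]] by (simp add: msub_def msc_def)

lemma op_bound_zero: "op_bound S (\<lambda>\<sigma> \<tau>. 0) 0"
  by (simp add: op_bound_def mvec_def vnorm_def)

lemma op_bound_mid: "finite S \<Longrightarrow> op_bound S mid 1"
proof -
  assume "finite S"
  then have "vnorm S (mvec S mid w) = vnorm S w" for w
    by (intro vnorm_cong) (simp add: mvec_def mid_def if_distrib[of "\<lambda>x. x * _"] cong: if_cong)
  then show ?thesis by (simp add: op_bound_def)
qed

lemma op_bound_sum: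
  assumes "finite J" "\<And>j. j \<in> J \<Longrightarrow> op_bound S (f j) (K j)"
  shows "op_bound S (\<lambda>\<sigma> \<tau>. \<Sum>j\<in>J. f j \<sigma> \<tau>) (\<Sum>j\<in>J. K j)"
  using assms by (induction J) (auto simp: op_bound_zero intro: op_bound_add)

lemma op_bound_mmul:
  assumes "op_bound S A K" "op_bound S B K'"
  shows "op_bound S (mmul S A B) (K * K')"
proof -
  have "vnorm S (mvec S A (mvec S B w)) \<le> K * K' * vnorm S w" for w
  proof -
    have "vnorm S (mvec S A (mvec S B w)) \<le> K * vnorm S (mvec S B w)"
      using assms(1) by (simp add: op_bound_def)
    also have "\<dots> \<le> K * (K' * vnorm S w)"
      using assms by (intro mult_left_mono) (auto simp: op_bound_def)
    finally show ?thesis by simp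
  qed
  then show ?thesis using assms by (simp add: op_bound_def mvec_mmul)
qed

lemma op_bound_mcomm:
  assumes "op_bound S A K" "op_bound S B K'"
  shows "op_bound S (mcomm S A B) (2 * K * K')"
  using op_bound_msub[OF op_bound_mmul[OF assms] op_bound_mmul[OF assms(2,1)]] by (simp add: mcomm_def mult_ac)

lemma opnorm_mvec: "opnorm S A = Sup {vnorm S (mvec S A w) | w. vnorm S w \<le> 1}"
  by (simp add: opnorm_def mvec_def)

lemma opnorm_le:
  assumes "op_bound S A K"
  shows "opnorm S A \<le> K"
  unfolding opnorm_mvec
proof (rule cSup_least)
  have "vnorm S (\<lambda>_. 0) \<le> 1" by (simp add: vnorm_def)
  then show "{vnorm S (mvec S A w) |w. vnorm S w \<le> 1} \<noteq> {}" by blast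
  fix x assume "x \<in> {vnorm S (mvec S A w) |w. vnorm S w \<le> 1}"
  then obtain w where w: "x = vnorm S (mvec S A w)" "vnorm S w \<le> 1" by auto
  have "x \<le> K * vnorm S w" using assms w by (simp add: op_bound_def)
  also have "\<dots> \<le> K * 1" using w op_bound_nonneg[OF assms] by (intro mult_left_mono)
  finally show "x \<le> K" by simp
qed

text \<open>Schur test: bounds K on row sums and on column sums give the operator bound sqrt (K * K)
  = K.\<close>

lemma op_bound_schur:
  assumes "finite S" "0 \<le> K"
    and row: "\<And>\<sigma>. \<sigma> \<in> S \<Longrightarrow> (\<Sum>\<tau>\<in>S. cmod (A \<sigma> \<tau>)) \<le> K"
    and col: "\<And>\<tau>. \<tau> \<in> S \<Longrightarrow> (\<Sum>\<sigma>\<in>S. cmod (A \<sigma> \<tau>)) \<le> K"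
  shows "op_bound S A K"
proof -
  have "vnorm S (mvec S A w) \<le> K * vnorm S w" for w
  proof -
    have one: "(cmod (mvec S A w \<sigma>))\<^sup>2 \<le> K * (\<Sum>\<kappa>\<in>S. cmod (A \<sigma> \<kappa>) * (cmod (w \<kappa>))\<^sup>2)" if "\<sigma> \<in> S" for \<sigma>
    proof -
      \<comment> \<open>Splitting |A| into two square roots makes Cauchy-Schwarz produce a row sum,
        bounded by K, and a weighted sum whose total over rows gives column sums.\<close>
      have "cmod (mvec S A w \<sigma>) \<le> (\<Sum>\<kappa>\<in>S. sqrt (cmod (A \<sigma> \<kappa>)) * (sqrt (cmod (A \<sigma> \<kappa>)) * cmod (w \<kappa>)))"
        unfolding mvec_def by (rule order.trans[OF norm_sum]) (simp add: norm_mult mult.assoc[symmetric])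
      then have "(cmod (mvec S A w \<sigma>))\<^sup>2 \<le> (\<Sum>\<kappa>\<in>S. sqrt (cmod (A \<sigma> \<kappa>)) * (sqrt (cmod (A \<sigma> \<kappa>)) * cmod (w \<kappa>)))\<^sup>2"
        by (intro power_mono) auto
      also have "\<dots> \<le> (\<Sum>\<kappa>\<in>S. (sqrt (cmod (A \<sigma> \<kappa>)))\<^sup>2) * (\<Sum>\<kappa>\<in>S. (sqrt (cmod (A \<sigma> \<kappa>)) * cmod (w \<kappa>))\<^sup>2)"
        by (rule Cauchy_Schwarz_ineq_sum)
      also have "\<dots> = (\<Sum>\<kappa>\<in>S. cmod (A \<sigma> \<kappa>)) * (\<Sum>\<kappa>\<in>S. cmod (A \<sigma> \<kappa>) * (cmod (w \<kappa>))\<^sup>2)"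
        by (simp add: power_mult_distrib)
      also have "\<dots> \<le> K * (\<Sum>\<kappa>\<in>S. cmod (A \<sigma> \<kappa>) * (cmod (w \<kappa>))\<^sup>2)"
        using row[OF that] by (intro mult_right_mono sum_nonneg) auto
      finally show ?thesis .
    qed
    have "(\<Sum>\<sigma>\<in>S. (cmod (mvec S A w \<sigma>))\<^sup>2) \<le> (\<Sum>\<sigma>\<in>S. K * (\<Sum>\<kappa>\<in>S. cmod (A \<sigma> \<kappa>) * (cmod (w \<kappa>))\<^sup>2))"
      by (intro sum_mono one)
    also have "\<dots> = K * (\<Sum>\<kappa>\<in>S. (\<Sum>\<sigma>\<in>S. cmod (A \<sigma> \<kappa>)) * (cmod (w \<kappa>))\<^sup>2)"
      unfolding sum_distrib_left[symmetric] sum_distrib_right by (subst sum.swap) simp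
    also have "\<dots> \<le> K * (\<Sum>\<kappa>\<in>S. K * (cmod (w \<kappa>))\<^sup>2)"
      using col assms(2) by (intro mult_left_mono sum_mono mult_right_mono) auto
    also have "\<dots> = K\<^sup>2 * (\<Sum>\<kappa>\<in>S. (cmod (w \<kappa>))\<^sup>2)"
      by (simp add: sum_distrib_left power2_eq_square mult.assoc)
    finally show ?thesis
      unfolding vnorm_def using assms(2) by (metis real_sqrt_le_mono real_sqrt_mult real_sqrt_abs abs_of_nonneg)
  qed
  then show ?thesis using assms(2) by (simp add: op_bound_def)
qed

text \<open>The Schur test makes the supremum over the unit ball finite; homogeneity carries the
  bound from the ball to all vectors.\<close>

lemma op_bound_opnorm:
  assumes "finite S"
  shows "op_bound S A (opnorm S A)"
proof -
  define K where "K = (\<Sum>\<sigma>\<in>S. \<Sum>\<tau>\<in>S. cmod (A \<sigma> \<tau>))"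
  have "op_bound S A K"
  proof (rule op_bound_schur[OF assms])
    show "0 \<le> K" by (simp add: K_def sum_nonneg)
    show "(\<Sum>\<tau>\<in>S. cmod (A \<sigma> \<tau>)) \<le> K" if "\<sigma> \<in> S" for \<sigma>
      unfolding K_def using assms that
      by (intro member_le_sum[where f = "\<lambda>\<sigma>. \<Sum>\<tau>\<in>S. cmod (A \<sigma> \<tau>)"]) (auto intro: sum_nonneg)
    show "(\<Sum>\<sigma>\<in>S. cmod (A \<sigma> \<tau>)) \<le> K" if "\<tau> \<in> S" for \<tau>
      unfolding K_def using assms that by (intro sum_mono member_le_sum) auto
  qed
  then have K: "vnorm S (mvec S A w) \<le> K * vnorm S w" and K0: "0 \<le> K" for w
    by (auto simp: op_bound_def)
  have bdd: "bdd_above {vnorm S (mvec S A w) | w. vnorm S w \<le> 1}"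
  proof (rule bdd_aboveI[of _ K])
    fix x assume "x \<in> {vnorm S (mvec S A w) | w. vnorm S w \<le> 1}"
    then obtain w where w: "x = vnorm S (mvec S A w)" "vnorm S w \<le> 1" by auto
    have "x \<le> K * vnorm S w" using w K by simp
    also have "\<dots> \<le> K * 1" using w K0 by (intro mult_left_mono)
    finally show "x \<le> K" by simp
  qed
  have up: "vnorm S (mvec S A w) \<le> opnorm S A" if "vnorm S w \<le> 1" for w
    unfolding opnorm_mvec using that by (intro cSup_upper bdd) auto
  have nonneg: "0 \<le> opnorm S A"
    by (rule order.trans[OF vnorm_nonneg up[of "\<lambda>_. 0"]]) (simp add: vnorm_def)
  have "vnorm S (mvec S A w) \<le> opnorm S A * vnorm S w" for w
  \<comment> \<open>A vector of norm zero cannot be normalised; there the crude bound K already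
    gives zero.\<close>
  proof (cases "vnorm S w = 0")
    case True
    then show ?thesis using K[of w] by simp
  next
    case False
    define r where "r = vnorm S w"
    have r: "r > 0" using False vnorm_nonneg[of S w] by (simp add: r_def)
    have "vnorm S (\<lambda>\<sigma>. complex_of_real (1 / r) * w \<sigma>) = 1"
      using r unfolding vnorm_scale norm_of_real by (simp add: r_def)
    then have "vnorm S (mvec S A (\<lambda>\<sigma>. complex_of_real (1 / r) * w \<sigma>)) \<le> opnorm S A"
      using up by simp
    moreover have "mvec S A (\<lambda>\<sigma>. complex_of_real (1 / r) * w \<sigma>) = (\<lambda>\<sigma>. complex_of_real (1 / r) * mvec S A w \<sigma>)"
      by (simp add: mvec_def sum_distrib_left mult_ac)
    ultimately have "1 / r * vnorm S (mvec S A w) \<le> opnorm S A"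
      using r unfolding vnorm_scale norm_of_real by (simp only: vnorm_scale norm_of_real) simp
    then show ?thesis using r by (simp add: r_def field_simps)
  qed
  then show ?thesis using nonneg by (simp add: op_bound_def)
qed

section \<open>The Hilbert-Schmidt norm\<close>

lemma hs_norm_nonneg: "0 \<le> hs_norm S A"
  by (simp add: hs_norm_def L2_set_nonneg)

lemma hs_norm_power2: "(hs_norm S A)\<^sup>2 = (\<Sum>\<sigma>\<in>S. \<Sum>\<tau>\<in>S. (cmod (A \<sigma> \<tau>))\<^sup>2)"
  unfolding hs_norm_def L2_set_def
  by (subst real_sqrt_pow2) (auto simp: sum.cartesian_product intro!: sum_nonneg sum.cong)

text \<open>The trace pairs A entrywise with the transpose of B, and transposition preserves the sum
  of squares, so this is Cauchy-Schwarz on S \<times> S.\<close>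

lemma mtr_mmul_le_hs_norm: "cmod (mtr S (mmul S A B)) \<le> hs_norm S A * hs_norm S B"
proof -
  have eq: "hs_norm S B = L2_set (\<lambda>(\<sigma>, \<tau>). cmod (B \<tau> \<sigma>)) (S \<times> S)"
  proof -
    have "(hs_norm S B)\<^sup>2 = (\<Sum>\<tau>\<in>S. \<Sum>\<sigma>\<in>S. (cmod (B \<sigma> \<tau>))\<^sup>2)"
      unfolding hs_norm_power2 by (rule sum.swap)
    also have "\<dots> = (L2_set (\<lambda>(\<sigma>, \<tau>). cmod (B \<tau> \<sigma>)) (S \<times> S))\<^sup>2"
      unfolding L2_set_def
      by (subst real_sqrt_pow2) (auto simp: sum.cartesian_product intro!: sum_nonneg sum.cong)
    finally show ?thesis by (simp add: hs_norm_nonneg L2_set_nonneg)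
  qed
  have "mtr S (mmul S A B) = (\<Sum>(\<sigma>, \<kappa>)\<in>S \<times> S. A \<sigma> \<kappa> * B \<kappa> \<sigma>)"
    by (simp add: mtr_def mmul_def sum.cartesian_product)
  then have "cmod (mtr S (mmul S A B)) \<le> (\<Sum>p\<in>S \<times> S. \<bar>case p of (\<sigma>, \<tau>) \<Rightarrow> cmod (A \<sigma> \<tau>)\<bar> * \<bar>case p of (\<sigma>, \<tau>) \<Rightarrow> cmod (B \<tau> \<sigma>)\<bar>)"
    by (simp only:) (rule order.trans[OF norm_sum], auto simp: norm_mult intro!: sum_mono)
  also have "\<dots> \<le> hs_norm S A * hs_norm S B"
    unfolding eq unfolding hs_norm_def by (rule L2_set_mult_ineq)
  finally show ?thesis .
qed

text \<open>Left multiplication acts on each column separately, and the squared Hilbert-Schmidt norm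
  is the sum of the squared column norms.\<close>

lemma hs_norm_mmul_le:
  assumes "op_bound S A K"
  shows "hs_norm S (mmul S A B) \<le> K * hs_norm S B"
proof -
  have col: "(hs_norm S D)\<^sup>2 = (\<Sum>\<tau>\<in>S. (vnorm S (\<lambda>\<sigma>. D \<sigma> \<tau>))\<^sup>2)" for D
    unfolding hs_norm_power2 vnorm_def by (subst sum.swap) (simp add: sum_nonneg)
  have "(hs_norm S (mmul S A B))\<^sup>2 \<le> (\<Sum>\<tau>\<in>S. (K * vnorm S (\<lambda>\<sigma>. B \<sigma> \<tau>))\<^sup>2)"
    unfolding col
  proof (intro sum_mono power_mono vnorm_nonneg)
    fix \<tau>
    have "(\<lambda>\<sigma>. mmul S A B \<sigma> \<tau>) = mvec S A (\<lambda>\<sigma>. B \<sigma> \<tau>)"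
      by (simp add: mvec_def mmul_def)
    then show "vnorm S (\<lambda>\<sigma>. mmul S A B \<sigma> \<tau>) \<le> K * vnorm S (\<lambda>\<sigma>. B \<sigma> \<tau>)"
      using assms by (simp add: op_bound_def)
  qed
  also have "\<dots> = (K * hs_norm S B)\<^sup>2"
    by (simp add: power_mult_distrib col sum_distrib_left)
  finally show ?thesis
    using op_bound_nonneg[OF assms] hs_norm_nonneg by (meson mult_nonneg_nonneg power2_le_imp_le)
qed

lemma herm_cnj: "herm S A \<Longrightarrow> \<sigma> \<in> S \<Longrightarrow> \<tau> \<in> S \<Longrightarrow> cnj (A \<sigma> \<tau>) = A \<tau> \<sigma>"
  unfolding herm_def by (metis complex_cnj_cnj)

text \<open>For Hermitian \<open>D\<close> and \<open>F\<close>, \<open>F D\<close> is the adjoint of \<open>D F\<close>.\<close>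

lemma hs_norm_mmul_commute:
  assumes "herm S D" "herm S F"
  shows "hs_norm S (mmul S F D) = hs_norm S (mmul S D F)"
proof -
  have "cnj (mmul S D F \<sigma> \<tau>) = mmul S F D \<tau> \<sigma>" if "\<sigma> \<in> S" "\<tau> \<in> S" for \<sigma> \<tau>
    unfolding mmul_def using that assms by (simp add: herm_cnj mult.commute)
  then have "cmod (mmul S F D \<tau> \<sigma>) = cmod (mmul S D F \<sigma> \<tau>)" if "\<sigma> \<in> S" "\<tau> \<in> S" for \<sigma> \<tau>
    using that by (metis complex_mod_cnj)
  then have "(hs_norm S (mmul S F D))\<^sup>2 = (hs_norm S (mmul S D F))\<^sup>2"
    unfolding hs_norm_power2 by (subst sum.swap) simp
  then show ?thesis by (simp add: hs_norm_nonneg)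
qed

text \<open>The squared norm is the trace of D F times its adjoint F D, and cyclicity moves the last
  D to the front. With F F proportional to the state this is a second moment of D.\<close>

lemma hs_norm_mmul_power2:
  assumes "herm S D" "herm S F"
  shows "complex_of_real ((hs_norm S (mmul S D F))\<^sup>2) = mtr S (mmul S (mmul S D D) (mmul S F F))"
proof -
  have cn: "cnj (mmul S D F \<sigma> \<tau>) = mmul S F D \<tau> \<sigma>" if "\<sigma> \<in> S" "\<tau> \<in> S" for \<sigma> \<tau>
    unfolding mmul_def using that assms by (simp add: herm_cnj mult.commute)
  have "complex_of_real ((hs_norm S (mmul S D F))\<^sup>2) = (\<Sum>\<sigma>\<in>S. \<Sum>\<tau>\<in>S. mmul S D F \<sigma> \<tau> * mmul S F D \<tau> \<sigma>)"
    unfolding hs_norm_power2 of_real_sum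
    by (intro sum.cong refl) (simp add: cn[symmetric] complex_norm_square flip: of_real_power)
  also have "\<dots> = mtr S (mmul S (mmul S D F) (mmul S F D))"
    by (simp add: mtr_def mmul_def)
  also have "\<dots> = mtr S (mmul S D (mmul S (mmul S F F) D))"
    by (simp add: mmul_assoc)
  also have "\<dots> = mtr S (mmul S (mmul S (mmul S F F) D) D)"
    by (rule mtr_cyclic)
  also have "\<dots> = mtr S (mmul S (mmul S D D) (mmul S F F))"
    by (subst mtr_cyclic) (simp add: mmul_assoc)
  finally show ?thesis .
qed

section \<open>Exponentials and time evolution\<close>

lemma mmul_mid_left: "finite S \<Longrightarrow> \<sigma> \<in> S \<Longrightarrow> mmul S mid A \<sigma> \<tau> = A \<sigma> \<tau>"
  by (simp add: mmul_def mid_def if_distrib[of "\<lambda>x. x * _"] cong: if_cong)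

lemma mmul_mid_right: "finite S \<Longrightarrow> \<tau> \<in> S \<Longrightarrow> mmul S A mid \<sigma> \<tau> = A \<sigma> \<tau>"
  by (simp add: mmul_def mid_def if_distrib[of "\<lambda>x. _ * x"] cong: if_cong)

lemma mmul_mid_mid: "finite S \<Longrightarrow> mmul S A (mmul S mid B) = mmul S A B"
  by (intro ext mmul_cong) (auto simp: mmul_mid_left)

lemma mpow_msc: "mpow S (msc z G) k = msc (z ^ k) (mpow S G k)"
  by (induction k) (simp_all add: mmul_msc_left mmul_msc_right, simp_all add: msc_def mult_ac)

text \<open>Geometric growth of the entries lets a scalar exponential series dominate the series of
  each matrix entry.\<close>

lemma mpow_bound:
  assumes "finite S"
  shows "\<exists>M\<ge>0. \<forall>k. \<forall>\<sigma>\<in>S. \<forall>\<tau>\<in>S. cmod (mpow S G k \<sigma> \<tau>) \<le> M ^ k"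
proof -
  define M where "M = (\<Sum>\<sigma>\<in>S. \<Sum>\<tau>\<in>S. cmod (G \<sigma> \<tau>))"
  have M0: "0 \<le> M" by (simp add: M_def sum_nonneg)
  have row: "(\<Sum>\<tau>\<in>S. cmod (G \<sigma> \<tau>)) \<le> M" if "\<sigma> \<in> S" for \<sigma>
    unfolding M_def using assms that
    by (intro member_le_sum[where f = "\<lambda>\<sigma>. \<Sum>\<tau>\<in>S. cmod (G \<sigma> \<tau>)"]) (auto intro: sum_nonneg)
  have "cmod (mpow S G k \<sigma> \<tau>) \<le> M ^ k" if "\<sigma> \<in> S" "\<tau> \<in> S" for k \<sigma> \<tau>
    using that
  proof (induction k arbitrary: \<sigma>)
    case 0
    then show ?case by (simp add: mid_def)
  next
    case (Suc k)
    have "cmod (mpow S G (Suc k) \<sigma> \<tau>) \<le> (\<Sum>\<kappa>\<in>S. cmod (G \<sigma> \<kappa>) * cmod (mpow S G k \<kappa> \<tau>))"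
      by (simp add: mmul_def) (rule order.trans[OF norm_sum], simp add: norm_mult)
    also have "\<dots> \<le> (\<Sum>\<kappa>\<in>S. cmod (G \<sigma> \<kappa>) * M ^ k)"
      using Suc by (intro sum_mono mult_left_mono) auto
    also have "\<dots> = (\<Sum>\<kappa>\<in>S. cmod (G \<sigma> \<kappa>)) * M ^ k"
      by (simp add: sum_distrib_right)
    also have "\<dots> \<le> M * M ^ k"
      using M0 Suc row by (intro mult_right_mono) auto
    finally show ?case by simp
  qed
  then show ?thesis using M0 by blast
qed

lemma summable_mexp:
  assumes "finite S" "\<sigma> \<in> S" "\<tau> \<in> S"
  shows "summable (\<lambda>k. mpow S G k \<sigma> \<tau> / fact k * z ^ k)"
proof -
  obtain M where M: "M \<ge> 0" "\<And>k. cmod (mpow S G k \<sigma> \<tau>) \<le> M ^ k"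
    using mpow_bound[OF assms(1), of G] assms by blast
  have "summable (\<lambda>k. (M * cmod z) ^ k /\<^sub>R fact k)"
    using exp_converges[of "M * cmod z"] by (rule sums_summable)
  then show ?thesis
  proof (rule summable_comparison_test'[where N = 0])
    fix k
    have "norm (mpow S G k \<sigma> \<tau> / fact k * z ^ k) = cmod (mpow S G k \<sigma> \<tau>) * cmod z ^ k / fact k"
      by (simp add: norm_mult norm_divide norm_power)
    also have "\<dots> \<le> M ^ k * cmod z ^ k / fact k"
      by (intro divide_right_mono mult_right_mono M) auto
    finally show "norm (mpow S G k \<sigma> \<tau> / fact k * z ^ k) \<le> (M * cmod z) ^ k /\<^sub>R fact k"
      by (simp add: power_mult_distrib divide_inverse mult_ac)
  qed
qed

text \<open>With the scalar pulled out, every entry on S is an everywhere convergent power series in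
  z and can be differentiated termwise.\<close>

lemma mexp_msc: "mexp S (msc z G) \<sigma> \<tau> = (\<Sum>k. mpow S G k \<sigma> \<tau> / fact k * z ^ k)"
  unfolding mexp_def mpow_msc by (simp add: msc_def mult_ac)

lemma mmul_mexp:
  assumes "finite S" "\<tau> \<in> S"
  shows "mmul S G (mexp S (msc z G)) \<sigma> \<tau> = (\<Sum>k. mpow S G (Suc k) \<sigma> \<tau> / fact k * z ^ k)"
proof -
  have "(\<Sum>k. mpow S G (Suc k) \<sigma> \<tau> / fact k * z ^ k)
      = (\<Sum>k. \<Sum>\<kappa>\<in>S. G \<sigma> \<kappa> * (mpow S G k \<kappa> \<tau> / fact k * z ^ k))"
    by (simp add: mmul_def sum_divide_distrib sum_distrib_right mult.assoc)
  also have "\<dots> = (\<Sum>\<kappa>\<in>S. \<Sum>k. G \<sigma> \<kappa> * (mpow S G k \<kappa> \<tau> / fact k * z ^ k))"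
    using assms by (intro suminf_sum summable_mult summable_mexp) auto
  also have "\<dots> = mmul S G (mexp S (msc z G)) \<sigma> \<tau>"
    unfolding mmul_def mexp_msc using assms
    by (intro sum.cong refl suminf_mult summable_mexp) auto
  finally show ?thesis by simp
qed

text \<open>The recursion of \<open>mpow\<close> multiplies on the left; this provides the
  right-hand version. At k = 0 the identity matrix forces the indices into S.\<close>

lemma mpow_commute:
  assumes "finite S" "\<sigma> \<in> S" "\<tau> \<in> S"
  shows "mmul S (mpow S G k) G \<sigma> \<tau> = mmul S G (mpow S G k) \<sigma> \<tau>"
  using assms(2)
proof (induction k arbitrary: \<sigma>)
  case 0
  then show ?case using assms by (simp add: mmul_mid_left mmul_mid_right)
next
  case (Suc k)
  have "mmul S (mpow S G (Suc k)) G \<sigma> \<tau> = mmul S G (mmul S (mpow S G k) G) \<sigma> \<tau>"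
    by (simp add: mmul_assoc)
  also have "\<dots> = mmul S G (mmul S G (mpow S G k)) \<sigma> \<tau>"
    by (rule mmul_cong) (use Suc in auto)
  finally show ?case by simp
qed

lemma mexp_commute:
  assumes "finite S" "\<sigma> \<in> S" "\<tau> \<in> S"
  shows "mmul S (mexp S (msc z G)) G \<sigma> \<tau> = mmul S G (mexp S (msc z G)) \<sigma> \<tau>"
proof -
  have "mmul S (mexp S (msc z G)) G \<sigma> \<tau> = (\<Sum>\<kappa>\<in>S. \<Sum>k. mpow S G k \<sigma> \<kappa> / fact k * z ^ k * G \<kappa> \<tau>)"
    unfolding mmul_def mexp_msc using assms
    by (intro sum.cong refl suminf_mult2 summable_mexp) auto
  also have "\<dots> = (\<Sum>k. \<Sum>\<kappa>\<in>S. mpow S G k \<sigma> \<kappa> / fact k * z ^ k * G \<kappa> \<tau>)"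
    using assms by (intro suminf_sum[symmetric] summable_mult2 summable_mexp) auto
  also have "\<dots> = (\<Sum>k. mmul S (mpow S G k) G \<sigma> \<tau> / fact k * z ^ k)"
    unfolding mmul_def sum_divide_distrib sum_distrib_right by (simp add: mult_ac)
  also have "\<dots> = (\<Sum>k. mpow S G (Suc k) \<sigma> \<tau> / fact k * z ^ k)"
    using assms by (simp add: mpow_commute)
  also have "\<dots> = mmul S G (mexp S (msc z G)) \<sigma> \<tau>"
    using assms by (simp only: mmul_mexp)
  finally show ?thesis .
qed

lemma DERIV_mexp:
  assumes "finite S" "\<sigma> \<in> S" "\<tau> \<in> S"
  shows "((\<lambda>z. mexp S (msc z G) \<sigma> \<tau>) has_field_derivative mmul S G (mexp S (msc z G)) \<sigma> \<tau>) (at z)"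
proof -
  have "((\<lambda>z. \<Sum>k. mpow S G k \<sigma> \<tau> / fact k * z ^ k) has_field_derivative
         (\<Sum>k. diffs (\<lambda>k. mpow S G k \<sigma> \<tau> / fact k) k * z ^ k)) (at z)"
    using summable_mexp[OF assms] by (intro termdiffs_strong_converges_everywhere)
  moreover have "diffs (\<lambda>k. mpow S G k \<sigma> \<tau> / fact k) k = mpow S G (Suc k) \<sigma> \<tau> / fact k" for k
    by (simp add: diffs_def fact_Suc del: mpow.simps of_nat_Suc)
  ultimately show ?thesis
    using assms by (simp only: mexp_msc mmul_mexp)
qed

lemma DERIV_mexp_affine:
  assumes "finite S" "\<sigma> \<in> S" "\<tau> \<in> S"
  shows "((\<lambda>u. mexp S (msc (a + b * u) G) \<sigma> \<tau>) has_field_derivative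
           b * mmul S G (mexp S (msc (a + b * u) G)) \<sigma> \<tau>) (at u)"
proof -
  have "((\<lambda>u. a + b * u) has_field_derivative b) (at u)"
    by (auto intro!: derivative_eq_intros)
  from DERIV_chain2[where f = "\<lambda>z. mexp S (msc z G) \<sigma> \<tau>", OF DERIV_mexp[OF assms] this]
  show ?thesis by (simp only: mult.commute)
qed

lemma mexp_zero:
  "mexp S (msc 0 G) \<sigma> \<tau> = mid \<sigma> \<tau>"
  unfolding mexp_msc using powser_zero[of "\<lambda>k. mpow S G k \<sigma> \<tau> / fact k"] by simp

text \<open>The map u -> E(u) E(z + w - u) has derivative zero because G commutes with its
  exponential; its values at u = z and u = 0 are the two sides.\<close>

lemma mexp_add:
  assumes "finite S" "\<sigma> \<in> S" "\<tau> \<in> S"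
  shows "mmul S (mexp S (msc z G)) (mexp S (msc w G)) \<sigma> \<tau> = mexp S (msc (z + w) G) \<sigma> \<tau>"
proof -
  let ?E = "\<lambda>z. mexp S (msc z G)"
  define f where "f u = mmul S (?E u) (?E (z + w - u)) \<sigma> \<tau>" for u
  have "(f has_field_derivative 0) (at u)" for u
  proof -
    have d2: "((\<lambda>u. ?E (z + w - u) \<kappa> \<tau>) has_field_derivative - mmul S G (?E (z + w - u)) \<kappa> \<tau>) (at u)"
      if "\<kappa> \<in> S" for \<kappa>
      using DERIV_mexp_affine[OF assms(1) that assms(3), of "z + w" "-1" G u] by simp
    have "(f has_field_derivative (\<Sum>\<kappa>\<in>S. ?E u \<sigma> \<kappa> * (- mmul S G (?E (z + w - u)) \<kappa> \<tau>)
              + mmul S G (?E u) \<sigma> \<kappa> * ?E (z + w - u) \<kappa> \<tau>)) (at u)"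
      unfolding f_def mmul_def[of S "?E _"]
      using assms by (intro DERIV_sum DERIV_mult' d2 DERIV_mexp) auto
    also have "(\<Sum>\<kappa>\<in>S. ?E u \<sigma> \<kappa> * (- mmul S G (?E (z + w - u)) \<kappa> \<tau>) + mmul S G (?E u) \<sigma> \<kappa> * ?E (z + w - u) \<kappa> \<tau>)
        = mmul S (mmul S G (?E u)) (?E (z + w - u)) \<sigma> \<tau> - mmul S (?E u) (mmul S G (?E (z + w - u))) \<sigma> \<tau>"
      by (simp add: mmul_def[of S "?E u"] mmul_def[of S "mmul S G (?E u)"] sum.distrib sum_subtractf)
    also have "mmul S (mmul S G (?E u)) (?E (z + w - u)) \<sigma> \<tau> = mmul S (mmul S (?E u) G) (?E (z + w - u)) \<sigma> \<tau>"
      by (rule mmul_cong) (use assms in \<open>auto simp: mexp_commute\<close>)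
    also have "\<dots> - mmul S (?E u) (mmul S G (?E (z + w - u))) \<sigma> \<tau> = 0"
      by (simp add: mmul_assoc)
    finally show ?thesis .
  qed
  then obtain k where "\<And>u. f u = k"
    using has_field_derivative_zero_constant[of UNIV f] by auto
  then have "f z = f 0" by simp
  also have "f 0 = mmul S mid (?E (z + w)) \<sigma> \<tau>"
    unfolding f_def by (rule mmul_cong) (use assms in \<open>auto simp: mexp_zero\<close>)
  finally show ?thesis using assms by (simp add: f_def mmul_mid_left)
qed

section \<open>Hermitian generators: unitarity and the derivative of the evolution\<close>

lemma cnj_mpow:
  assumes "finite S" "herm S G" "\<sigma> \<in> S" "\<tau> \<in> S"
  shows "cnj (mpow S G k \<sigma> \<tau>) = mpow S G k \<tau> \<sigma>"
  using assms(3,4)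
proof (induction k arbitrary: \<sigma> \<tau>)
  case 0
  then show ?case by (simp add: mid_def)
next
  case (Suc k)
  have "cnj (mpow S G (Suc k) \<sigma> \<tau>) = mmul S (mpow S G k) G \<tau> \<sigma>"
    using Suc assms(2) by (simp add: mmul_def herm_cnj mult.commute)
  also have "\<dots> = mpow S G (Suc k) \<tau> \<sigma>"
    using assms(1) Suc.prems by (simp add: mpow_commute)
  finally show ?case .
qed

lemma cnj_mexp:
  assumes "finite S" "herm S G" "\<sigma> \<in> S" "\<tau> \<in> S"
  shows "cnj (mexp S (msc z G) \<sigma> \<tau>) = mexp S (msc (cnj z) G) \<tau> \<sigma>"
proof -
  have "(\<lambda>k. cnj (mpow S G k \<sigma> \<tau> / fact k * z ^ k)) sums cnj (mexp S (msc z G) \<sigma> \<tau>)"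
    unfolding mexp_msc sums_cnj using assms by (intro summable_sums summable_mexp)
  moreover have "cnj (mpow S G k \<sigma> \<tau> / fact k * z ^ k) = mpow S G k \<tau> \<sigma> / fact k * cnj z ^ k" for k
    using cnj_mpow[OF assms] by simp
  ultimately have "(\<lambda>k. mpow S G k \<tau> \<sigma> / fact k * cnj z ^ k) sums cnj (mexp S (msc z G) \<sigma> \<tau>)"
    by (simp only:)
  then show ?thesis unfolding mexp_msc[of S "cnj z"] by (rule sums_unique)
qed

text \<open>The adjoint of the exponential of i t G is the exponential of -i t G, and by
  \<open>mexp_add\<close> their product is the identity on S.\<close>

lemma vnorm_mexp_unitary:
  assumes "finite S" "herm S G"
  shows "vnorm S (mvec S (mexp S (msc (\<i> * complex_of_real t) G)) w) = vnorm S w"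
proof -
  let ?U = "mexp S (msc (\<i> * complex_of_real t) G)" and ?V = "mexp S (msc (- (\<i> * complex_of_real t)) G)"
  have sq: "complex_of_real ((vnorm S u)\<^sup>2) = (\<Sum>\<sigma>\<in>S. cnj (u \<sigma>) * u \<sigma>)" for u
    unfolding vnorm_def
    by (simp add: real_sqrt_pow2 sum_nonneg complex_norm_square mult.commute del: of_real_power flip: of_real_power)
  have "complex_of_real ((vnorm S (mvec S ?U w))\<^sup>2) = (\<Sum>\<sigma>\<in>S. (\<Sum>\<kappa>\<in>S. cnj (w \<kappa>) * ?V \<kappa> \<sigma>) * mvec S ?U w \<sigma>)"
    unfolding sq using assms
    by (intro sum.cong refl) (simp add: mvec_def cnj_mexp mult.commute)
  also have "\<dots> = (\<Sum>\<kappa>\<in>S. cnj (w \<kappa>) * mvec S ?V (mvec S ?U w) \<kappa>)"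
    unfolding mvec_def[of S ?V] sum_distrib_left sum_distrib_right
    by (subst sum.swap) (simp add: mult.assoc)
  also have "\<dots> = (\<Sum>\<kappa>\<in>S. cnj (w \<kappa>) * w \<kappa>)"
  proof (intro sum.cong refl arg_cong2[where f = "(*)"])
    fix \<kappa> assume k: "\<kappa> \<in> S"
    have "mvec S ?V (mvec S ?U w) \<kappa> = (\<Sum>l\<in>S. mid \<kappa> l * w l)"
      using assms k unfolding mvec_mmul[symmetric] unfolding mvec_def
      by (intro sum.cong refl) (simp add: mexp_add mexp_zero)
    also have "\<dots> = w \<kappa>"
      using assms k by (simp add: mid_def if_distrib[of "\<lambda>x. x * _"] cong: if_cong)
    finally show "mvec S ?V (mvec S ?U w) \<kappa> = w \<kappa>" .
  qed
  finally have "complex_of_real ((vnorm S (mvec S ?U w))\<^sup>2) = complex_of_real ((vnorm S w)\<^sup>2)"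
    by (simp only: sq)
  then have "(vnorm S (mvec S ?U w))\<^sup>2 = (vnorm S w)\<^sup>2"
    by (simp only: of_real_eq_iff)
  then show ?thesis by (simp add: vnorm_nonneg)
qed

lemma op_bound_mexp_unitary:
  assumes "finite S" "herm S G"
  shows "op_bound S (mexp S (msc (\<i> * complex_of_real t) G)) 1"
  using vnorm_mexp_unitary[OF assms] by (simp add: op_bound_def)

lemma op_bound_evol:
  assumes "finite S" "herm S G" "op_bound S A K"
  shows "op_bound S (evol S G A t) K"
proof -
  have "op_bound S (mexp S (msc (\<i> * complex_of_real (- t)) G)) 1"
    using assms by (intro op_bound_mexp_unitary)
  then show ?thesis
    unfolding evol_def
    using op_bound_mmul[OF op_bound_mmul[OF op_bound_mexp_unitary[OF assms(1,2), of t] assms(3)]] by fastforce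
qed

text \<open>Both exponentials are differentiated in a complex variable, which is then restricted to
  the real line. For the evolved operator B the two terms are i G B and -i B G.\<close>

lemma has_vector_derivative_evol:
  assumes "finite S" "\<sigma> \<in> S" "\<tau> \<in> S"
  shows "((\<lambda>t. evol S G A t \<sigma> \<tau>) has_vector_derivative (- \<i> * mcomm S (evol S G A t) G \<sigma> \<tau>)) (at t)"
proof -
  let ?U = "\<lambda>z. mexp S (msc (\<i> * z) G)" and ?V = "\<lambda>z. mexp S (msc (- \<i> * z) G)"
  let ?z = "complex_of_real t"
  define f where "f z = mmul S (mmul S (?U z) A) (?V z) \<sigma> \<tau>" for z
  have dU: "((\<lambda>z. ?U z \<kappa> l) has_field_derivative msc \<i> (mmul S G (?U ?z)) \<kappa> l) (at ?z)" if "\<kappa> \<in> S" "l \<in> S" for \<kappa> l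
    using DERIV_mexp_affine[OF assms(1) that, of 0 "\<i>" G ?z] by (simp add: msc_def[of \<i>])
  have dV: "((\<lambda>z. ?V z \<kappa> l) has_field_derivative - \<i> * mmul S G (?V ?z) \<kappa> l) (at ?z)" if "\<kappa> \<in> S" "l \<in> S" for \<kappa> l
    using DERIV_mexp_affine[OF assms(1) that, of 0 "- \<i>" G ?z] by simp
  have dUA: "((\<lambda>z. mmul S (?U z) A \<sigma> \<kappa>) has_field_derivative mmul S (msc \<i> (mmul S G (?U ?z))) A \<sigma> \<kappa>) (at ?z)"
    if "\<kappa> \<in> S" for \<kappa>
    unfolding mmul_def[of S _ A] using assms
    by (intro DERIV_sum DERIV_cmult_right dU) auto
  have "(f has_field_derivative (\<Sum>\<kappa>\<in>S. mmul S (?U ?z) A \<sigma> \<kappa> * (- \<i> * mmul S G (?V ?z) \<kappa> \<tau>)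
            + mmul S (msc \<i> (mmul S G (?U ?z))) A \<sigma> \<kappa> * ?V ?z \<kappa> \<tau>)) (at ?z)"
    unfolding f_def mmul_def[of S "mmul S _ A"]
    using assms by (intro DERIV_sum DERIV_mult' dUA dV)
  also have "(\<Sum>\<kappa>\<in>S. mmul S (?U ?z) A \<sigma> \<kappa> * (- \<i> * mmul S G (?V ?z) \<kappa> \<tau>)
            + mmul S (msc \<i> (mmul S G (?U ?z))) A \<sigma> \<kappa> * ?V ?z \<kappa> \<tau>)
      = mmul S (mmul S (?U ?z) A) (msc (- \<i>) (mmul S G (?V ?z))) \<sigma> \<tau>
        + mmul S (mmul S (msc \<i> (mmul S G (?U ?z))) A) (?V ?z) \<sigma> \<tau>"
    by (simp add: mmul_def[of S "mmul S _ A"] msc_def[of "- \<i>"] sum_subtractf sum_negf)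
  \<comment> \<open>Differentiation puts G to the left of the second exponential; commuting it to
    the right end makes the evolved operator reappear.\<close>
  also have "mmul S (mmul S (?U ?z) A) (msc (- \<i>) (mmul S G (?V ?z))) \<sigma> \<tau>
      = mmul S (mmul S (?U ?z) A) (msc (- \<i>) (mmul S (?V ?z) G)) \<sigma> \<tau>"
    by (rule mmul_cong) (use assms in \<open>auto simp: mexp_commute msc_def[of "- \<i>"]\<close>)
  finally have "(f has_field_derivative - \<i> * mcomm S (evol S G A t) G \<sigma> \<tau>) (at ?z)"
    unfolding mmul_msc_left mmul_msc_right
    by (simp add: evol_def mcomm_def msc_def msub_def mmul_assoc algebra_simps)
  then have "((f \<circ> complex_of_real) has_vector_derivative 1 * (- \<i> * mcomm S (evol S G A t) G \<sigma> \<tau>)) (at t)"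
    by (intro field_vector_diff_chain_at) (auto intro!: derivative_eq_intros)
  moreover have "f \<circ> complex_of_real = (\<lambda>t. evol S G A t \<sigma> \<tau>)"
    by (simp add: f_def evol_def fun_eq_iff)
  ultimately show ?thesis by simp
qed

lemma has_vector_derivative_mtr_evol:
  assumes "finite S"
  shows "((\<lambda>t. mtr S (mmul S (evol S G A t) R)) has_vector_derivative
           (- \<i> * mtr S (mmul S (mcomm S (evol S G A t) G) R))) (at t)"
proof -
  have "((\<lambda>t. mtr S (mmul S (evol S G A t) R)) has_vector_derivative
          (\<Sum>\<sigma>\<in>S. \<Sum>\<kappa>\<in>S. (- \<i> * mcomm S (evol S G A t) G \<sigma> \<kappa>) * R \<kappa> \<sigma>)) (at t)"
    unfolding mtr_def mmul_def[of S "evol S G A _"]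
    using assms by (intro has_vector_derivative_sum has_vector_derivative_mult_left has_vector_derivative_evol)
  then show ?thesis
    by (simp add: mtr_def mmul_def sum_distrib_left mult.assoc sum_negf)
qed

section \<open>Gibbs states and noncommutative monomials\<close>

text \<open>Presenting \<open>\<rho>\<close> through a Hermitian square root makes the spectral theorem unnecessary.\<close>

definition gibbs_root :: "('s \<Rightarrow> nat) set \<Rightarrow> 's op \<Rightarrow> real \<Rightarrow> 's op \<Rightarrow> bool" where
  "gibbs_root S F Z R \<longleftrightarrow> finite S \<and> herm S F \<and> Z > 0 \<and> mtr S (mmul S F F) = complex_of_real Z
     \<and> (\<forall>\<sigma>\<in>S. \<forall>\<tau>\<in>S. R \<sigma> \<tau> = mmul S F F \<sigma> \<tau> / complex_of_real Z)"

lemma mtr_gibbs_root: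
  assumes "gibbs_root S F Z R"
  shows "mtr S (mmul S M R) = mtr S (mmul S M (mmul S F F)) / Z"
proof -
  have "mtr S (mmul S M R) = mtr S (mmul S M (msc (1 / Z) (mmul S F F)))"
    using assms by (intro mtr_mmul_cong) (auto simp: gibbs_root_def msc_def)
  then show ?thesis by (simp add: mmul_msc_right mtr_msc)
qed

text \<open>Converts variances in the state into the norms that occur in Cauchy-Schwarz.\<close>

lemma gibbs_hs_norm:
  assumes "gibbs_root S F Z R" "herm S D"
  shows "hs_norm S (mmul S D F) = sqrt Z * sqrt (cmod (mtr S (mmul S (mmul S D D) R)))"
proof -
  have Z: "Z > 0" using assms by (simp add: gibbs_root_def)
  have "complex_of_real ((hs_norm S (mmul S D F))\<^sup>2) / Z = mtr S (mmul S (mmul S D D) R)"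
    using hs_norm_mmul_power2[OF assms(2), of F] assms(1) unfolding mtr_gibbs_root[OF assms(1)]
    by (simp add: gibbs_root_def)
  then have "cmod (mtr S (mmul S (mmul S D D) R)) = (hs_norm S (mmul S D F))\<^sup>2 / Z"
    using Z by (metis abs_of_nonneg divide_nonneg_pos norm_of_real of_real_divide zero_le_power2)
  then have "Z * cmod (mtr S (mmul S (mmul S D D) R)) = (hs_norm S (mmul S D F))\<^sup>2"
    using Z by simp
  then show ?thesis by (simp add: real_sqrt_mult[symmetric] hs_norm_nonneg)
qed

text \<open>The case where D is the identity, whose second moment is 1.\<close>

lemma gibbs_hs_norm_root:
  assumes "gibbs_root S F Z R"
  shows "hs_norm S F = sqrt Z"
proof -
  have Z: "Z > 0" and fin: "finite S" using assms by (auto simp: gibbs_root_def)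
  have id: "herm S mid" by (auto simp: herm_def mid_def)
  have "hs_norm S (mmul S mid F) = hs_norm S F"
  proof -
    have "(hs_norm S (mmul S mid F))\<^sup>2 = (hs_norm S F)\<^sup>2"
      unfolding hs_norm_power2 using fin by (simp add: mmul_mid_left)
    then show ?thesis by (simp add: hs_norm_nonneg)
  qed
  moreover have "mtr S (mmul S (mmul S mid mid) R) = 1"
  proof -
    have "mtr S (mmul S (mmul S mid mid) R) = mtr S (mmul S mid (mmul S mid (mmul S F F))) / Z"
      by (subst mtr_gibbs_root[OF assms]) (simp add: mmul_assoc)
    also have "mtr S (mmul S mid (mmul S mid (mmul S F F))) = mtr S (mmul S F F)"
      using fin by (intro mtr_cong) (simp add: mmul_mid_left)
    finally show ?thesis using assms by (simp add: gibbs_root_def)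
  qed
  ultimately show ?thesis using gibbs_hs_norm[OF assms id] by simp
qed

text \<open>Cyclicity turns the trace into that of F (M (D F)). Cauchy-Schwarz separates F from the
  rest, and the two factors sqrt Z cancel the normalisation.\<close>

lemma gibbs_right:
  assumes "gibbs_root S F Z R" "herm S D" "op_bound S M K"
  shows "cmod (mtr S (mmul S (mmul S M D) R)) \<le> K * sqrt (cmod (mtr S (mmul S (mmul S D D) R)))"
proof -
  have Z: "Z > 0" using assms by (simp add: gibbs_root_def)
  have "mtr S (mmul S (mmul S M D) (mmul S F F)) = mtr S (mmul S F (mmul S M (mmul S D F)))"
    by (subst mtr_cyclic[of S F]) (simp add: mmul_assoc)
  then have "cmod (mtr S (mmul S (mmul S M D) (mmul S F F))) \<le> hs_norm S F * hs_norm S (mmul S M (mmul S D F))"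
    using mtr_mmul_le_hs_norm by metis
  also have "\<dots> \<le> hs_norm S F * (K * hs_norm S (mmul S D F))"
    by (intro mult_left_mono hs_norm_mmul_le assms hs_norm_nonneg)
  also have "\<dots> = Z * (K * sqrt (cmod (mtr S (mmul S (mmul S D D) R))))"
    unfolding gibbs_hs_norm_root[OF assms(1)] gibbs_hs_norm[OF assms(1,2)] using Z by simp
  finally show ?thesis
    unfolding mtr_gibbs_root[OF assms(1)] using Z by (simp add: norm_divide field_simps)
qed

text \<open>By cyclicity D reaches the state from its other side: the trace becomes that of (F D) (M
  F), and F D has the same norm as D F.\<close>

lemma gibbs_left:
  assumes "gibbs_root S F Z R" "herm S D" "op_bound S M K"
  shows "cmod (mtr S (mmul S (mmul S D M) R)) \<le> K * sqrt (cmod (mtr S (mmul S (mmul S D D) R)))"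
proof -
  have Z: "Z > 0" and F: "herm S F" using assms by (simp_all add: gibbs_root_def)
  have "mtr S (mmul S (mmul S D M) (mmul S F F)) = mtr S (mmul S (mmul S F D) (mmul S M F))"
    by (subst (2) mmul_assoc, subst mtr_cyclic[of S F]) (simp add: mmul_assoc)
  then have "cmod (mtr S (mmul S (mmul S D M) (mmul S F F))) \<le> hs_norm S (mmul S F D) * hs_norm S (mmul S M F)"
    using mtr_mmul_le_hs_norm by metis
  also have "\<dots> \<le> hs_norm S (mmul S D F) * (K * hs_norm S F)"
    unfolding hs_norm_mmul_commute[OF assms(2) F] by (intro mult_left_mono hs_norm_mmul_le assms hs_norm_nonneg)
  also have "\<dots> = Z * (K * sqrt (cmod (mtr S (mmul S (mmul S D D) R))))"
    unfolding gibbs_hs_norm_root[OF assms(1)] gibbs_hs_norm[OF assms(1,2)] using Z by simp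
  finally show ?thesis
    unfolding mtr_gibbs_root[OF assms(1)] using Z by (simp add: norm_divide field_simps)
qed

lemma gibbs_trace_le:
  assumes "gibbs_root S F Z R" "op_bound S M K"
  shows "cmod (mtr S (mmul S M R)) \<le> K"
proof -
  have Z: "Z > 0" using assms by (simp add: gibbs_root_def)
  have "mtr S (mmul S M (mmul S F F)) = mtr S (mmul S F (mmul S M F))"
    by (subst mtr_cyclic[of S F]) (simp add: mmul_assoc)
  then have "cmod (mtr S (mmul S M (mmul S F F))) \<le> hs_norm S F * hs_norm S (mmul S M F)"
    using mtr_mmul_le_hs_norm by metis
  also have "\<dots> \<le> hs_norm S F * (K * hs_norm S F)"
    by (intro mult_left_mono hs_norm_mmul_le assms hs_norm_nonneg)
  also have "\<dots> = Z * K"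
    unfolding gibbs_hs_norm_root[OF assms(1)] using Z by simp
  finally show ?thesis
    unfolding mtr_gibbs_root[OF assms(1)] using Z by (simp add: norm_divide field_simps)
qed

text \<open>F is the exponential at half the parameter. Hermiticity makes the trace of F F a sum of
  squares, and invertibility of F makes it positive.\<close>

lemma gibbs_root_mexp:
  assumes "finite S" "S \<noteq> {}" "herm S H"
  shows "\<exists>F Z. gibbs_root S F Z (msc (1 / mtr S (mexp S (msc (complex_of_real b) H))) (mexp S (msc (complex_of_real b) H)))"
proof -
  let ?E = "mexp S (msc (complex_of_real b) H)"
  define F where "F = mexp S (msc (complex_of_real (b / 2)) H)"
  define G where "G = mexp S (msc (complex_of_real (- (b / 2))) H)"
  have FF: "mmul S F F \<sigma> \<tau> = ?E \<sigma> \<tau>" if "\<sigma> \<in> S" "\<tau> \<in> S" for \<sigma> \<tau>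
    using mexp_add[OF assms(1) that, of "complex_of_real (b / 2)" H "complex_of_real (b / 2)"]
    unfolding F_def of_real_add[symmetric] by simp
  have F: "herm S F"
    unfolding F_def herm_def[of S "mexp _ _"] using assms by (simp add: cnj_mexp)
  define Z where "Z = (hs_norm S F)\<^sup>2"
  have tr: "mtr S (mmul S F F) = complex_of_real Z"
  proof -
    have "mtr S (mmul S F F) = (\<Sum>\<sigma>\<in>S. \<Sum>\<tau>\<in>S. F \<sigma> \<tau> * cnj (F \<sigma> \<tau>))"
      unfolding mtr_def mmul_def using F by (intro sum.cong refl) (simp add: herm_cnj)
    also have "\<dots> = complex_of_real Z"
      unfolding Z_def hs_norm_power2 of_real_sum by (simp only: complex_norm_square)
    finally show ?thesis .
  qed
  \<comment> \<open>A zero F would contradict F G = identity at a diagonal index, which exists as S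
    is nonempty.\<close>
  have "hs_norm S F \<noteq> 0"
  proof
    assume "hs_norm S F = 0"
    then have F0: "F \<sigma> \<tau> = 0" if "\<sigma> \<in> S" "\<tau> \<in> S" for \<sigma> \<tau>
      using that assms(1) unfolding hs_norm_def by (auto simp: L2_set_eq_0_iff)
    obtain \<sigma> where \<sigma>: "\<sigma> \<in> S" using assms(2) by (meson ex_in_conv)
    have "mmul S F G \<sigma> \<sigma> = mexp S (msc (complex_of_real (b / 2) + complex_of_real (- (b / 2))) H) \<sigma> \<sigma>"
      unfolding F_def G_def by (rule mexp_add[OF assms(1) \<sigma> \<sigma>])
    also have "complex_of_real (b / 2) + complex_of_real (- (b / 2)) = 0"
      by simp
    also have "mexp S (msc 0 H) \<sigma> \<sigma> = mid \<sigma> \<sigma>"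
      by (rule mexp_zero)
    finally have "mmul S F G \<sigma> \<sigma> = mid \<sigma> \<sigma>" .
    moreover have "mmul S F G \<sigma> \<sigma> = 0"
      using F0 \<sigma> by (simp add: mmul_def)
    ultimately show False by (simp add: mid_def)
  qed
  then have Z: "Z > 0" by (simp add: Z_def)
  have "mtr S ?E = complex_of_real Z"
    unfolding tr[symmetric] using FF by (intro mtr_cong) simp
  then have "gibbs_root S F Z (msc (1 / mtr S ?E) ?E)"
    unfolding gibbs_root_def using assms(1) F Z tr FF by (auto simp: msc_def[of "1 / _"])
  then show ?thesis by blast
qed

section \<open>Words in noncommuting observables\<close>

definition word :: "('s \<Rightarrow> nat) set \<Rightarrow> (nat \<Rightarrow> 's op) \<Rightarrow> nat list \<Rightarrow> 's op" where
  "word S x w = foldr (mmul S) (map x w) mid"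

lemma word_simps: "word S x [] = mid" "word S x (a # w) = mmul S (x a) (word S x w)"
  by (simp_all add: word_def)

text \<open>The partial derivative of the commutative monomial, computed along the word so that its
  recursion matches the Leibniz rule for commutators letter by letter.\<close>

primrec dword :: "nat \<Rightarrow> nat list \<Rightarrow> (nat \<Rightarrow> real) \<Rightarrow> real" where
  "dword i [] y = 0"
| "dword i (a # w) y = (if i = a then prod_list (map y w) else 0) + y a * dword i w y"

text \<open>Replacement cost of a word in units of \<open>k * s\<close>. At each letter two
  replacements occur, of the word after the commutator and of the letter before it; the error from
  the tail is multiplied by a mean value of size at most r.\<close>

primrec word_err :: "real \<Rightarrow> nat list \<Rightarrow> real" where
  "word_err r [] = 0"
| "word_err r (a # w) = 2 * real (length w) * r ^ length w + r * word_err r w"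

lemma word_err_nonneg: "0 \<le> r \<Longrightarrow> 0 \<le> word_err r w"
  by (induction w) auto

lemma abs_prod_list_le:
  fixes y :: "nat \<Rightarrow> real"
  assumes "0 \<le> r" "\<And>i. i \<in> set w \<Longrightarrow> \<bar>y i\<bar> \<le> r"
  shows "\<bar>prod_list (map y w)\<bar> \<le> r ^ length w"
  using assms by (induction w) (auto simp: abs_mult intro!: mult_mono)

text \<open>Only bounded Hermitian observables and their second moments about the numbers y are
  kept; the system size will enter through \<open>s\<close>. One r bounds both operators and
  numbers, and r \<ge> 1 allows powers of r to be enlarged.\<close>

locale gibbs_observables =
  fixes S :: "('s \<Rightarrow> nat) set" and F R :: "'s op" and Z :: real
    and x :: "nat \<Rightarrow> 's op" and y :: "nat \<Rightarrow> real" and m :: nat and r s :: real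
  assumes root: "gibbs_root S F Z R"
    and r_ge_1: "1 \<le> r" and s_nonneg: "0 \<le> s"
    and x_herm: "\<And>i. i < m \<Longrightarrow> herm S (x i)"
    and x_bound: "\<And>i. i < m \<Longrightarrow> op_bound S (x i) r"
    and y_bound: "\<And>i. i < m \<Longrightarrow> \<bar>y i\<bar> \<le> r"
    and x_var: "\<And>i. i < m \<Longrightarrow> cmod (mtr S (mmul S (mmul S (msub (x i) (msc (y i) mid)) (msub (x i) (msc (y i) mid))) R)) \<le> s\<^sup>2"
begin

lemma fin: "finite S"
  using root by (simp add: gibbs_root_def)

lemma herm_dev: "i < m \<Longrightarrow> herm S (msub (x i) (msc (complex_of_real (y i)) mid))"
  unfolding herm_def[of S "msub _ _"] by (auto simp: msub_def msc_def mid_def herm_cnj[OF x_herm])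

lemma sqrt_var: "i < m \<Longrightarrow> sqrt (cmod (mtr S (mmul S (mmul S (msub (x i) (msc (y i) mid)) (msub (x i) (msc (y i) mid))) R))) \<le> s"
  using x_var[of i] s_nonneg by (metis abs_of_nonneg real_sqrt_abs real_sqrt_le_mono)

lemma replace_right:
  assumes "i < m" "op_bound S M K"
  shows "cmod (mtr S (mmul S (mmul S M (x i)) R) - y i * mtr S (mmul S M R)) \<le> K * s"
proof -
  let ?D = "msub (x i) (msc (complex_of_real (y i)) mid)"
  have "mtr S (mmul S (mmul S M ?D) R) = mtr S (mmul S (mmul S M (x i)) R) - y i * mtr S (mmul S M R)"
    unfolding mmul_msub_right mmul_msub_left mtr_msub mmul_msc_right mmul_msc_left mtr_msc
    by (simp add: mmul_assoc mmul_mid_mid fin)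
  moreover have "cmod (mtr S (mmul S (mmul S M ?D) R)) \<le> K * s"
    using gibbs_right[OF root herm_dev[OF assms(1)] assms(2)] sqrt_var[OF assms(1)] op_bound_nonneg[OF assms(2)]
    by (meson mult_left_mono order.trans)
  ultimately show ?thesis by simp
qed

lemma replace_left:
  assumes "i < m" "op_bound S M K"
  shows "cmod (mtr S (mmul S (mmul S (x i) M) R) - y i * mtr S (mmul S M R)) \<le> K * s"
proof -
  let ?D = "msub (x i) (msc (complex_of_real (y i)) mid)"
  have "mtr S (mmul S (mmul S mid M) R) = mtr S (mmul S M R)"
    using fin by (intro mtr_mmul_cong) (auto simp: mmul_mid_left)
  then have "mtr S (mmul S (mmul S ?D M) R) = mtr S (mmul S (mmul S (x i) M) R) - y i * mtr S (mmul S M R)"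
    unfolding mmul_msub_right mmul_msub_left mtr_msub mmul_msc_right mmul_msc_left mtr_msc by simp
  moreover have "cmod (mtr S (mmul S (mmul S ?D M) R)) \<le> K * s"
    using gibbs_left[OF root herm_dev[OF assms(1)] assms(2)] sqrt_var[OF assms(1)] op_bound_nonneg[OF assms(2)]
    by (meson mult_left_mono order.trans)
  ultimately show ?thesis by simp
qed

lemma op_bound_word: "set w \<subseteq> {..<m} \<Longrightarrow> op_bound S (word S x w) (r ^ length w)"
  by (induction w) (auto simp: word_simps intro!: op_bound_mmul x_bound op_bound_mid fin)

text \<open>The tail of the word is treated first, with M x_a in place of M; afterwards x_a itself
  is adjacent to R. Hence the induction over all M and K.\<close>

lemma replace_word:
  assumes "set w \<subseteq> {..<m}" "op_bound S M K"
  shows "cmod (mtr S (mmul S (mmul S M (word S x w)) R) - prod_list (map y w) * mtr S (mmul S M R))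
          \<le> K * (real (length w) * r ^ length w) * s"
  using assms
proof (induction w arbitrary: M K)
  case Nil
  then show ?case by (simp add: word_simps mmul_assoc mmul_mid_mid fin)
next
  case (Cons a w)
  have a: "a < m" and w: "set w \<subseteq> {..<m}" using Cons.prems by auto
  have K: "0 \<le> K" using Cons.prems(2) by (rule op_bound_nonneg)
  let ?p = "complex_of_real (prod_list (map y w))"
  have 1: "cmod (mtr S (mmul S (mmul S (mmul S M (x a)) (word S x w)) R) - ?p * mtr S (mmul S (mmul S M (x a)) R))
       \<le> K * r * (real (length w) * r ^ length w) * s"
    by (rule Cons.IH[OF w op_bound_mmul[OF Cons.prems(2) x_bound[OF a]]])
  have "cmod (?p * (mtr S (mmul S (mmul S M (x a)) R) - y a * mtr S (mmul S M R))) \<le> r ^ length w * (K * s)"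
    unfolding norm_mult norm_of_real using r_ge_1 w y_bound
    by (intro mult_mono abs_prod_list_le replace_right a Cons.prems) auto
  also have "\<dots> \<le> r ^ length (a # w) * (K * s)"
    using r_ge_1 K s_nonneg by (intro mult_right_mono power_increasing) auto
  finally have 2: "cmod (?p * (mtr S (mmul S (mmul S M (x a)) R) - y a * mtr S (mmul S M R))) \<le> r ^ length (a # w) * (K * s)" .
  have "mtr S (mmul S (mmul S M (word S x (a # w))) R) - prod_list (map y (a # w)) * mtr S (mmul S M R)
      = (mtr S (mmul S (mmul S (mmul S M (x a)) (word S x w)) R) - ?p * mtr S (mmul S (mmul S M (x a)) R))
        + ?p * (mtr S (mmul S (mmul S M (x a)) R) - y a * mtr S (mmul S M R))"
    by (simp add: word_simps mmul_assoc algebra_simps)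
  then have "cmod (mtr S (mmul S (mmul S M (word S x (a # w))) R) - prod_list (map y (a # w)) * mtr S (mmul S M R))
      \<le> K * r * (real (length w) * r ^ length w) * s + r ^ length (a # w) * (K * s)"
    using norm_triangle_mono[OF 1 2] by simp
  also have "\<dots> = K * (real (length (a # w)) * r ^ length (a # w)) * s"
    by (simp add: algebra_simps)
  finally show ?case .
qed

text \<open>In the application B is the evolved observable, and \<open>k\<close> is 1/N times a
  bound of light-cone volume.\<close>

context
  fixes B :: "'s op" and k :: real
  assumes comm_bound: "\<And>i. i < m \<Longrightarrow> op_bound S (mcomm S B (x i)) k" and k_nonneg: "0 \<le> k"
begin

lemma op_bound_mcomm_word:
  "set w \<subseteq> {..<m} \<Longrightarrow> op_bound S (mcomm S B (word S x w)) (k * (real (length w) * r ^ length w))"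
proof (induction w)
  case Nil
  have "mcomm S B mid \<sigma> \<tau> = 0" if "\<sigma> \<in> S" "\<tau> \<in> S" for \<sigma> \<tau>
    using that fin by (simp add: mcomm_def msub_def mmul_mid_left mmul_mid_right)
  then show ?case by (intro op_bound_cong[OF _ op_bound_zero[of S, THEN op_bound_mono]]) (auto simp: word_simps)
next
  case (Cons a w)
  have a: "a < m" and w: "set w \<subseteq> {..<m}" using Cons.prems by auto
  have "op_bound S (mcomm S B (word S x (a # w))) (k * r ^ length w + r * (k * (real (length w) * r ^ length w)))"
    by (rule op_bound_cong[OF _ op_bound_add[OF op_bound_mmul[OF comm_bound[OF a] op_bound_word[OF w]] op_bound_mmul[OF x_bound[OF a] Cons.IH[OF w]]]])
      (simp add: word_simps mcomm_mmul)
  moreover have "r ^ length w \<le> r ^ length (a # w)"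
    using r_ge_1 by (intro power_increasing) auto
  then have "k * r ^ length w \<le> k * r ^ length (a # w)"
    using k_nonneg by (rule mult_left_mono)
  then have "k * r ^ length w + r * (k * (real (length w) * r ^ length w)) \<le> k * (real (length (a # w)) * r ^ length (a # w))"
    by (simp add: algebra_simps)
  ultimately show ?case by (rule op_bound_mono)
qed

text \<open>Each factor next to \<open>R\<close> is replaced by its expectation value; by cyclicity of the trace this
  works from both sides of the commutator, so the factors are never commuted past one another.\<close>

lemma mtr_mcomm_word:
  assumes "set w \<subseteq> {..<m}"
  shows "cmod (mtr S (mmul S (mcomm S B (word S x w)) R)
            - (\<Sum>i<m. dword i w y * mtr S (mmul S (mcomm S B (x i)) R))) \<le> k * word_err r w * s"
  using assms
proof (induction w)
  case Nil
  have "mtr S (mmul S (mcomm S B mid) R) = mtr S (mmul S (\<lambda>\<sigma> \<tau>. 0) R)"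
    using fin by (intro mtr_mmul_cong) (auto simp: mcomm_def msub_def mmul_mid_left mmul_mid_right)
  then show ?case by (simp add: word_simps mtr_def mmul_def)
next
  case (Cons a w)
  have a: "a < m" and w: "set w \<subseteq> {..<m}" using Cons.prems by auto
  let ?t = "\<lambda>i. mtr S (mmul S (mcomm S B (x i)) R)"
  let ?T = "\<lambda>w. mtr S (mmul S (mcomm S B (word S x w)) R)"
  let ?s = "\<lambda>w. \<Sum>i<m. complex_of_real (dword i w y) * ?t i"
  let ?p = "complex_of_real (prod_list (map y w))"
  let ?l = "real (length w) * r ^ length w"
  have "mcomm S B (word S x (a # w)) = (\<lambda>\<sigma> \<tau>. mmul S (mcomm S B (x a)) (word S x w) \<sigma> \<tau>
          + mmul S (x a) (mcomm S B (word S x w)) \<sigma> \<tau>)"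
    by (simp add: fun_eq_iff word_simps mcomm_mmul)
  then have T: "?T (a # w) = mtr S (mmul S (mmul S (mcomm S B (x a)) (word S x w)) R)
                       + mtr S (mmul S (mmul S (x a) (mcomm S B (word S x w))) R)"
    by (simp add: mtr_def mmul_def[of S _ R] distrib_right sum.distrib)
  have "?s (a # w) = (\<Sum>i<m. (if i = a then ?p * ?t i else 0) + y a * (complex_of_real (dword i w y) * ?t i))"
    by (intro sum.cong refl) (simp add: algebra_simps)
  also have "\<dots> = ?p * ?t a + y a * ?s w"
    using a by (simp add: sum.distrib sum_distrib_left)
  finally have s: "?s (a # w) = ?p * ?t a + y a * ?s w" .
  have 1: "cmod (mtr S (mmul S (mmul S (mcomm S B (x a)) (word S x w)) R) - ?p * ?t a) \<le> k * ?l * s"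
    by (rule replace_word[OF w comm_bound[OF a]])
  have 2: "cmod (mtr S (mmul S (mmul S (x a) (mcomm S B (word S x w))) R) - y a * ?T w) \<le> k * ?l * s"
    by (rule replace_left[OF a op_bound_mcomm_word[OF w]])
  have 3: "cmod (complex_of_real (y a) * (?T w - ?s w)) \<le> r * (k * word_err r w * s)"
    unfolding norm_mult norm_of_real using r_ge_1 by (intro mult_mono y_bound[OF a] Cons.IH[OF w]) auto
  have "?T (a # w) - ?s (a # w) = ((mtr S (mmul S (mmul S (mcomm S B (x a)) (word S x w)) R) - ?p * ?t a)
      + (mtr S (mmul S (mmul S (x a) (mcomm S B (word S x w))) R) - y a * ?T w)) + y a * (?T w - ?s w)"
    unfolding T s by (simp add: algebra_simps)
  then have "cmod (?T (a # w) - ?s (a # w)) \<le> (k * ?l * s + k * ?l * s) + r * (k * word_err r w * s)"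
    using norm_triangle_mono[OF norm_triangle_mono[OF 1 2] 3] by simp
  also have "\<dots> = k * word_err r (a # w) * s"
    by (simp add: algebra_simps)
  finally show ?case .
qed

lemma mtr_mcomm_ncev:
  assumes "\<And>w. c w \<noteq> 0 \<Longrightarrow> set w \<subseteq> {..<m}"
  shows "cmod (mtr S (mmul S (mcomm S B (ncev S c x)) R)
            - (\<Sum>i<m. (\<Sum>w\<in>{w. c w \<noteq> 0}. c w * dword i w y) * mtr S (mmul S (mcomm S B (x i)) R)))
         \<le> k * (\<Sum>w\<in>{w. c w \<noteq> 0}. \<bar>c w\<bar> * word_err r w) * s"
proof -
  let ?W = "{w. c w \<noteq> 0}"
  let ?t = "\<lambda>i. mtr S (mmul S (mcomm S B (x i)) R)"
  let ?T = "\<lambda>w. mtr S (mmul S (mcomm S B (word S x w)) R)"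
  have "ncev S c x = (\<lambda>\<sigma> \<tau>. \<Sum>w\<in>?W. msc (c w) (word S x w) \<sigma> \<tau>)"
    by (simp add: ncev_def word_def msc_def)
  then have 1: "mtr S (mmul S (mcomm S B (ncev S c x)) R) = (\<Sum>w\<in>?W. c w * ?T w)"
    by (simp only: mcomm_sum mtr_mmul_sum mcomm_msc mmul_msc_left mtr_msc)
  have 2: "(\<Sum>i<m. complex_of_real (\<Sum>w\<in>?W. c w * dword i w y) * ?t i) = (\<Sum>w\<in>?W. c w * (\<Sum>i<m. dword i w y * ?t i))"
    by (simp add: sum_distrib_left sum_distrib_right mult.assoc) (rule sum.swap)
  have "cmod (\<Sum>w\<in>?W. c w * (?T w - (\<Sum>i<m. dword i w y * ?t i))) \<le> (\<Sum>w\<in>?W. \<bar>c w\<bar> * (k * word_err r w * s))"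
  proof (intro sum_norm_le)
    fix w assume "w \<in> ?W"
    then have "set w \<subseteq> {..<m}" using assms by simp
    then show "cmod (c w * (?T w - (\<Sum>i<m. dword i w y * ?t i))) \<le> \<bar>c w\<bar> * (k * word_err r w * s)"
      unfolding norm_mult norm_of_real by (intro mult_left_mono mtr_mcomm_word) auto
  qed
  then show ?thesis
    unfolding 1 2 by (simp add: right_diff_distrib sum_subtractf sum_distrib_left sum_distrib_right mult_ac)
qed

end

end

section \<open>Local observables and lattice sums\<close>

lemma lattice_PiE: "lattice L = (PiE UNIV (\<lambda>_. {..<L}) :: ('n::finite \<Rightarrow> nat) set)"
  by (auto simp: lattice_def PiE_def)

lemma finite_lattice: "finite (lattice L)"
  unfolding lattice_PiE by (intro finite_PiE) auto

lemma card_lattice: "card (lattice L :: ('n::finite \<Rightarrow> nat) set) = L ^ CARD('n)"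
  unfolding lattice_PiE by (subst card_PiE) auto

lemma finite_cfgs:
  assumes "finite U"
  shows "finite (cfgs d U)"
proof (rule finite_subset)
  show "cfgs d U \<subseteq> {f. \<forall>x. (x \<in> U \<longrightarrow> f x \<in> {..<d}) \<and> (x \<notin> U \<longrightarrow> f x = 0)}"
    by (auto simp: cfgs_def)
  show "finite {f. \<forall>x. (x \<in> U \<longrightarrow> f x \<in> {..<d}) \<and> (x \<notin> U \<longrightarrow> f x = 0)}"
    using assms by (intro finite_set_of_finite_funs) auto
qed

lemma finite_Sp: "finite (Sp d L)"
  unfolding Sp_def by (intro finite_cfgs finite_lattice)

lemma Sp_nonempty: "1 \<le> d \<Longrightarrow> Sp d L \<noteq> {}"
proof -
  assume "1 \<le> d"
  then have "(\<lambda>_. 0) \<in> Sp d L" by (simp add: Sp_def cfgs_def)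
  then show ?thesis by (metis empty_iff)
qed

lemma shift_site_lattice: "1 \<le> L \<Longrightarrow> shift_site L j u \<in> lattice L"
  by (simp add: shift_site_def tor_def lattice_def nat_less_iff)

text \<open>Equal images force j and j' to agree modulo L in every coordinate, where both range
  below L. This turns sums over translations into sums over sites.\<close>

lemma shift_site_inj: "inj_on (\<lambda>j. shift_site L j u) (lattice L)"
proof (rule inj_onI, rule ext)
  fix j j' :: "'a \<Rightarrow> nat" and k
  assume j: "j \<in> lattice L" "j' \<in> lattice L" and eq: "shift_site L j u = shift_site L j' u"
  from j have lt: "j k < L" "j' k < L" by (simp_all add: lattice_def)
  then have "0 < int L" by simp
  then have nn: "0 \<le> (u k + int (j k)) mod int L" "0 \<le> (u k + int (j' k)) mod int L" by simp_all
  have "(u k + int (j k)) mod int L = (u k + int (j' k)) mod int L"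
    using fun_cong[OF eq, of k] nn by (simp add: shift_site_def tor_def)
  then have "int L dvd (u k + int (j k)) - (u k + int (j' k))"
    by (simp add: mod_eq_dvd_iff)
  then have "int L dvd int (j k) - int (j' k)" by simp
  then have "int (j k) - int (j' k) \<noteq> 0 \<Longrightarrow> \<bar>int L\<bar> \<le> \<bar>int (j k) - int (j' k)\<bar>"
    by (rule dvd_imp_le_int[rotated])
  then show "j k = j' k"
    using lt by linarith
qed

text \<open>The local configuration that the translated observable reads. On a small torus the
  translate may wrap onto itself, and then not every local configuration occurs.\<close>

definition pull :: "nat \<Rightarrow> ('n::finite \<Rightarrow> nat) \<Rightarrow> ('n \<Rightarrow> int) set \<Rightarrow> (('n \<Rightarrow> nat) \<Rightarrow> nat) \<Rightarrow> (('n \<Rightarrow> int) \<Rightarrow> nat)" where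
  "pull L j U \<sigma> = (\<lambda>u. if u \<in> U then \<sigma> (shift_site L j u) else 0)"

lemma embed_pull: "embed L j U a \<sigma> \<tau> =
    (if \<forall>x\<in>lattice L - shift_site L j ` U. \<sigma> x = \<tau> x then a (pull L j U \<sigma>) (pull L j U \<tau>) else 0)"
  by (simp add: embed_def pull_def)

lemma pull_cfgs: "1 \<le> L \<Longrightarrow> \<sigma> \<in> Sp d L \<Longrightarrow> pull L j U \<sigma> \<in> cfgs d U"
  using shift_site_lattice[of L j] by (auto simp: pull_def cfgs_def Sp_def)

lemma supported_in_embed:
  assumes "1 \<le> L"
  shows "supported_in d L (shift_site L j ` U) (embed L j U a)"
  unfolding supported_in_def
proof (intro exI ballI)
  fix \<sigma> \<tau> :: "('a \<Rightarrow> nat) \<Rightarrow> nat"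
  have "pull L j U (rst (shift_site L j ` U) \<sigma>) = pull L j U \<sigma>" for \<sigma>
    by (auto simp: pull_def rst_def fun_eq_iff)
  then show "embed L j U a \<sigma> \<tau> = (if \<forall>x\<in>lattice L - shift_site L j ` U. \<sigma> x = \<tau> x
      then (\<lambda>s t. a (pull L j U s) (pull L j U t)) (rst (shift_site L j ` U) \<sigma>) (rst (shift_site L j ` U) \<tau>) else 0)"
    by (simp add: embed_pull)
qed

lemma herm_embed:
  fixes U :: "('n::finite \<Rightarrow> int) set"
  assumes "1 \<le> L" "herm (cfgs d U) a"
  shows "herm (Sp d L) (embed L j U a)"
  unfolding herm_def[of "Sp d L"]
proof (intro ballI)
  fix \<sigma> \<tau> :: "('n \<Rightarrow> nat) \<Rightarrow> nat"
  assume "\<sigma> \<in> Sp d L" "\<tau> \<in> Sp d L"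
  then have "cnj (a (pull L j U \<tau>) (pull L j U \<sigma>)) = a (pull L j U \<sigma>) (pull L j U \<tau>)"
    using assms by (intro herm_cnj[OF assms(2)] pull_cfgs)
  then show "embed L j U a \<sigma> \<tau> = cnj (embed L j U a \<tau> \<sigma>)"
    by (auto simp: embed_pull)
qed

text \<open>A crude norm, taken before placement on the torus, so that one number bounds all
  translates for all L.\<close>

definition entry_sum :: "nat \<Rightarrow> ('n \<Rightarrow> int) set \<Rightarrow> ('n \<Rightarrow> int) op \<Rightarrow> real" where
  "entry_sum d U a = (\<Sum>s\<in>cfgs d U. \<Sum>t\<in>cfgs d U. cmod (a s t))"

lemma entry_sum_nonneg: "0 \<le> entry_sum d U a"
  by (simp add: entry_sum_def sum_nonneg)

text \<open>The Schur test also covers wrapping: the nonzero entries of a row are indexed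
  injectively by the pulled-back column, so each entry of a is counted at most once. Columns follow
  from rows by Hermiticity.\<close>

lemma op_bound_embed:
  assumes "1 \<le> L" "finite U" "herm (cfgs d U) a"
  shows "op_bound (Sp d L) (embed L j U a) (entry_sum d U a)"
proof (rule op_bound_schur)
  show row: "(\<Sum>\<tau>\<in>Sp d L. cmod (embed L j U a \<sigma> \<tau>)) \<le> entry_sum d U a" if \<sigma>: "\<sigma> \<in> Sp d L" for \<sigma>
  proof -
    define P where "P = {\<tau> \<in> Sp d L. \<forall>x\<in>lattice L - shift_site L j ` U. \<sigma> x = \<tau> x}"
    have inj: "inj_on (pull L j U) P"
    proof (rule inj_onI, rule ext)
      fix \<tau> \<tau>' x assume t: "\<tau> \<in> P" "\<tau>' \<in> P" and eq: "pull L j U \<tau> = pull L j U \<tau>'"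
      consider "x \<notin> lattice L" | "x \<in> lattice L - shift_site L j ` U" | u where "u \<in> U" "x = shift_site L j u"
        by blast
      then show "\<tau> x = \<tau>' x"
      proof cases
        case 1
        then show ?thesis using t by (simp add: P_def Sp_def cfgs_def)
      next
        case 2
        have "\<sigma> x = \<tau> x" "\<sigma> x = \<tau>' x" using t 2 unfolding P_def by blast+
        then show ?thesis by simp
      next
        case 3
        then show ?thesis using fun_cong[OF eq, of u] by (simp add: pull_def)
      qed
    qed
    have "(\<Sum>\<tau>\<in>Sp d L. cmod (embed L j U a \<sigma> \<tau>)) = (\<Sum>\<tau>\<in>P. cmod (a (pull L j U \<sigma>) (pull L j U \<tau>)))"
      unfolding P_def embed_pull
      by (simp add: sum.inter_filter[OF finite_Sp] if_distrib[of cmod] cong: if_cong)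
    also have "\<dots> = (\<Sum>t\<in>pull L j U ` P. cmod (a (pull L j U \<sigma>) t))"
      by (simp add: sum.reindex[OF inj])
    also have "\<dots> \<le> (\<Sum>t\<in>cfgs d U. cmod (a (pull L j U \<sigma>) t))"
      using assms by (intro sum_mono2 finite_cfgs) (auto simp: P_def intro!: pull_cfgs)
    also have "\<dots> \<le> entry_sum d U a"
      unfolding entry_sum_def using assms \<sigma>
      by (intro member_le_sum[where f = "\<lambda>s. \<Sum>t\<in>cfgs d U. cmod (a s t)"] pull_cfgs finite_cfgs)
        (auto intro: sum_nonneg)
    finally show ?thesis .
  qed
  show "(\<Sum>\<sigma>\<in>Sp d L. cmod (embed L j U a \<sigma> \<tau>)) \<le> entry_sum d U a" if \<tau>: "\<tau> \<in> Sp d L" for \<tau>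
  proof -
    have "(\<Sum>\<sigma>\<in>Sp d L. cmod (embed L j U a \<sigma> \<tau>)) = (\<Sum>\<sigma>\<in>Sp d L. cmod (embed L j U a \<tau> \<sigma>))"
      using herm_cnj[OF herm_embed[OF assms(1,3)]] \<tau> by (intro sum.cong refl) (metis complex_mod_cnj)
    then show ?thesis using row[OF \<tau>] by simp
  qed
qed (simp_all add: finite_Sp entry_sum_nonneg)

section \<open>Exponential sums over the periodic lattice\<close>

lemma sum_exp_tail:
  fixes a T :: real
  assumes "a > 0" "T \<ge> 0"
  shows "(\<Sum>n\<le>L. exp (- a * max 0 (real n - T))) \<le> (1 + 1 / (1 - exp (- a))) * (1 + T)"
proof -
  \<comment> \<open>T rounded up: the first k terms are bounded by 1, and beyond them n - k \<le> n
    - T gives a geometric tail.\<close>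
  define k where "k = nat \<lceil>T\<rceil>"
  define q where "q = exp (- a)"
  have q: "0 < q" "q < 1" using assms by (simp_all add: q_def)
  have k: "T \<le> real k" "real k \<le> T + 1" using assms by (auto simp: k_def)
  have bound: "exp (- a * max 0 (real n - T)) \<le> (if n < k then 1 else q ^ (n - k))" for n
  proof (cases "n < k")
    case True
    then show ?thesis using assms by simp
  next
    case False
    have "real (n - k) \<le> max 0 (real n - T)" using False k by simp
    then have "- a * max 0 (real n - T) \<le> real (n - k) * (- a)" using assms by (simp add: mult.commute)
    then show ?thesis using False unfolding q_def exp_of_nat_mult[symmetric] by simp
  qed
  have "(\<Sum>n\<le>L. exp (- a * max 0 (real n - T))) \<le> (\<Sum>n\<le>L. if n < k then 1 else q ^ (n - k))"
    by (intro sum_mono bound)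
  \<comment> \<open>The range is extended past k so that it splits at k even when k > L.\<close>
  also have "\<dots> \<le> (\<Sum>n<k + Suc L. if n < k then 1 else q ^ (n - k))"
    using q by (intro sum_mono2) auto
  also have "\<dots> = (\<Sum>n<k. 1) + (\<Sum>n<Suc L. q ^ n)"
  proof -
    have "(\<Sum>n<k. if n < k then 1 else q ^ (n - k)) = (\<Sum>n<k. 1)"
      by (intro sum.cong) auto
    then have "(\<Sum>n<k + M. if n < k then 1 else q ^ (n - k)) = (\<Sum>n<k. 1) + (\<Sum>n<M. q ^ n)" for M
      by (induction M) auto
    then show ?thesis .
  qed
  also have "\<dots> \<le> (T + 1) + 1 / (1 - q)"
  proof -
    have "(\<Sum>n<Suc L. q ^ n) \<le> (\<Sum>n. q ^ n)"
      using q by (intro sum_le_suminf summable_geometric) auto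
    also have "\<dots> = 1 / (1 - q)" using q by (simp add: suminf_geometric)
    finally show ?thesis using k by simp
  qed
  also have "\<dots> \<le> (1 + 1 / (1 - q)) * (1 + T)"
    using mult_left_mono[of 1 "1 + T" "1 / (1 - q)"] q assms by (simp add: distrib_right)
  finally show ?thesis by (simp add: q_def)
qed

definition cdist :: "nat \<Rightarrow> nat \<Rightarrow> nat \<Rightarrow> nat" where
  "cdist L a b = min (nat \<bar>int a - int b\<bar>) (L - nat \<bar>int a - int b\<bar>)"

lemma tdist_cdist: "tdist L x y = (\<Sum>k\<in>UNIV. cdist L (x k) (y k))"
  by (simp add: tdist_def cdist_def)

lemma sum_inj_le:
  fixes h :: "'b \<Rightarrow> real"
  assumes "inj_on f A" "f ` A \<subseteq> B" "finite B" "\<And>b. 0 \<le> h b"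
  shows "(\<Sum>a\<in>A. h (f a)) \<le> (\<Sum>b\<in>B. h b)"
proof -
  have "(\<Sum>a\<in>A. h (f a)) = (\<Sum>b\<in>f ` A. h b)"
    using assms by (simp add: sum.reindex)
  also have "\<dots> \<le> (\<Sum>b\<in>B. h b)"
    using assms by (intro sum_mono2) auto
  finally show ?thesis .
qed

text \<open>The factor 4: the cyclic distance is |a - b| or L - |a - b|, and each of these takes a
  given value at most twice, once on either side of a.\<close>

lemma sum_cdist_le:
  fixes h :: "nat \<Rightarrow> real"
  assumes "a < L" "\<And>n. 0 \<le> h n"
  shows "(\<Sum>b<L. h (cdist L a b)) \<le> 4 * (\<Sum>n\<le>L. h n)"
proof -
  define p where "p b = nat \<bar>int a - int b\<bar>" for b
  have pL: "p b < L" if "b < L" for b using that assms by (simp add: p_def nat_less_iff)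
  \<comment> \<open>The site a lies in both halves; counting it twice only enlarges a sum of
    nonnegative terms.\<close>
  have split: "{..<L} = {..a} \<union> {a..<L}" using assms by auto
  have two: "(\<Sum>b<L. h (f b)) \<le> 2 * (\<Sum>n\<le>L. h n)"
    if "inj_on f {..a}" "inj_on f {a..<L}" "\<And>b. b < L \<Longrightarrow> f b \<le> L" for f
  proof -
    have "(\<Sum>b<L. h (f b)) \<le> (\<Sum>b\<in>{..a}. h (f b)) + (\<Sum>b\<in>{a..<L}. h (f b))"
      unfolding split by (subst sum.union_inter[symmetric]) (auto intro!: sum_nonneg assms)
    also have "\<dots> \<le> (\<Sum>n\<le>L. h n) + (\<Sum>n\<le>L. h n)"
      using that assms by (intro add_mono sum_inj_le) auto
    finally show ?thesis by simp
  qed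
  have 1: "(\<Sum>b<L. h (p b)) \<le> 2 * (\<Sum>n\<le>L. h n)"
    by (rule two) (use pL in \<open>auto simp: p_def inj_on_def less_imp_le\<close>)
  have 2: "(\<Sum>b<L. h (L - p b)) \<le> 2 * (\<Sum>n\<le>L. h n)"
    by (rule two) (use assms in \<open>auto simp: p_def inj_on_def\<close>)
  have "(\<Sum>b<L. h (cdist L a b)) \<le> (\<Sum>b<L. h (p b) + h (L - p b))"
    by (intro sum_mono) (auto simp: cdist_def p_def min_def assms)
  also have "\<dots> \<le> 4 * (\<Sum>n\<le>L. h n)"
    using 1 2 by (simp add: sum.distrib)
  finally show ?thesis .
qed

text \<open>The distance is at least each coordinate distance, hence at least their mean; this splits
  the lattice sum into a product of one-dimensional sums.\<close>

lemma sum_lattice_exp: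
  fixes x :: "'n::finite \<Rightarrow> nat" and mu T :: real
  assumes "mu > 0" "T \<ge> 0" "x \<in> lattice L"
  defines "a \<equiv> mu / real CARD('n)"
  shows "(\<Sum>z\<in>lattice L. exp (- mu * max 0 (real (tdist L x z) - T)))
           \<le> (4 * (1 + 1 / (1 - exp (- a)))) ^ CARD('n) * (1 + T) ^ CARD('n)"
proof -
  have a: "a > 0" using assms by (simp add: a_def)
  define h where "h n = exp (- a * max 0 (real n - T))" for n
  have "exp (- mu * max 0 (real (tdist L x z) - T)) \<le> (\<Prod>k\<in>UNIV. h (cdist L (x k) (z k)))" for z
  proof -
    have "(\<Sum>k\<in>UNIV. max 0 (real (cdist L (x k) (z k)) - T)) \<le> (\<Sum>k\<in>(UNIV::'n set). max 0 (real (tdist L x z) - T))"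
    proof (rule sum_mono)
      fix k :: 'n
      have "cdist L (x k) (z k) \<le> tdist L x z"
        unfolding tdist_cdist by (intro member_le_sum) auto
      then show "max 0 (real (cdist L (x k) (z k)) - T) \<le> max 0 (real (tdist L x z) - T)"
        by simp
    qed
    then have "a * (\<Sum>k\<in>UNIV. max 0 (real (cdist L (x k) (z k)) - T)) \<le> a * (real CARD('n) * max 0 (real (tdist L x z) - T))"
      using a by (intro mult_left_mono) auto
    also have "\<dots> = mu * max 0 (real (tdist L x z) - T)"
      by (simp add: a_def)
    finally have "- mu * max 0 (real (tdist L x z) - T) \<le> (\<Sum>k\<in>UNIV. - a * max 0 (real (cdist L (x k) (z k)) - T))"
      by (simp add: sum_distrib_left sum_negf)
    then have "exp (- mu * max 0 (real (tdist L x z) - T)) \<le> exp (\<Sum>k\<in>UNIV. - a * max 0 (real (cdist L (x k) (z k)) - T))"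
      by (simp only: exp_le_cancel_iff)
    also have "\<dots> = (\<Prod>k\<in>UNIV. h (cdist L (x k) (z k)))"
      unfolding h_def by (rule exp_sum) simp
    finally show ?thesis .
  qed
  then have "(\<Sum>z\<in>lattice L. exp (- mu * max 0 (real (tdist L x z) - T)))
      \<le> (\<Sum>z\<in>lattice L. \<Prod>k\<in>UNIV. h (cdist L (x k) (z k)))"
    by (intro sum_mono)
  also have "\<dots> = (\<Prod>k\<in>UNIV. \<Sum>b<L. h (cdist L (x k) b))"
    unfolding lattice_PiE by (subst prod_sum_PiE) auto
  also have "\<dots> \<le> (\<Prod>k\<in>(UNIV::'n set). 4 * (1 + 1 / (1 - exp (- a))) * (1 + T))"
  proof (intro prod_mono conjI)
    fix k :: 'n
    have "(\<Sum>b<L. h (cdist L (x k) b)) \<le> 4 * (\<Sum>n\<le>L. h n)"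
      using assms by (intro sum_cdist_le) (auto simp: lattice_def h_def)
    also have "\<dots> \<le> 4 * ((1 + 1 / (1 - exp (- a))) * (1 + T))"
      unfolding h_def using a assms by (intro mult_left_mono sum_exp_tail) auto
    finally show "(\<Sum>b<L. h (cdist L (x k) b)) \<le> 4 * (1 + 1 / (1 - exp (- a))) * (1 + T)"
      by (simp only: mult.assoc)
  qed (simp add: h_def sum_nonneg)
  also have "\<dots> = (4 * (1 + 1 / (1 - exp (- a)))) ^ CARD('n) * (1 + T) ^ CARD('n)"
    by (simp only: prod_constant power_mult_distrib)
  finally show ?thesis .
qed

section \<open>Commutators summed over all translates\<close>

lemma sum_shift_le:
  fixes h :: "('n::finite \<Rightarrow> nat) \<Rightarrow> real"
  assumes "1 \<le> L" "\<And>z. 0 \<le> h z"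
  shows "(\<Sum>j\<in>lattice L. h (shift_site L j u)) \<le> (\<Sum>z\<in>lattice L. h z)"
  using assms by (intro sum_inj_le[OF shift_site_inj]) (auto simp: finite_lattice intro: shift_site_lattice)

text \<open>A nearest pair allows decay in the set distance to be dominated by a sum over all pairs
  of sites, which can then be summed over translations.\<close>

lemma setdist_attained:
  assumes "finite U" "finite V" "U \<noteq> {}" "V \<noteq> {}"
  shows "\<exists>x\<in>U. \<exists>y\<in>V. setdist L U V = real (tdist L x y)"
proof -
  let ?D = "{tdist L x y | x y. x \<in> U \<and> y \<in> V}"
  have D: "?D = (\<lambda>(x, y). tdist L x y) ` (U \<times> V)" by auto
  have "Min ?D \<in> ?D"
    using assms unfolding D by (intro Min_in) auto
  then show ?thesis unfolding setdist_def by auto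
qed

text \<open>Merges two bounds into one: A is used inside the light cone, z \<le> 0, and the decaying
  one outside.\<close>

lemma mult_exp_min_le:
  fixes A P mu z :: real
  assumes "0 \<le> A" "0 \<le> P" "X \<le> A" "X \<le> P * exp (- mu * z)" "mu > 0"
  shows "X \<le> (A + P) * exp (- mu * max 0 z)"
proof (cases "z \<le> 0")
  case True
  then show ?thesis using assms by (simp add: max_def)
next
  case False
  then have "P * exp (- mu * z) \<le> (A + P) * exp (- mu * max 0 z)"
    using assms by (simp add: max_def mult_right_mono)
  then show ?thesis using assms(4) by linarith
qed

text \<open>Sites farther than \<open>v \<bar>t\<bar>\<close> contribute by the Lieb--Robinson bound, the others by the trivial
  bound on the commutator.\<close>

lemma sum_commutators_bound:
  fixes UA Uo :: "('n::finite \<Rightarrow> int) set" and C mu v :: real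
  assumes C: "C > 0" and mu: "mu > 0" and v: "v > 0"
    and LR: "\<And>L U V A B t. 1 \<le> L \<Longrightarrow> U \<subseteq> lattice L \<Longrightarrow> V \<subseteq> lattice L
               \<Longrightarrow> supported_in d L U A \<Longrightarrow> herm (Sp d L) A
               \<Longrightarrow> supported_in d L V B \<Longrightarrow> herm (Sp d L) B \<Longrightarrow>
               opnorm (Sp d L) (mcomm (Sp d L) (evol (Sp d L) (G L) A t) B)
                  \<le> C * opnorm (Sp d L) A * opnorm (Sp d L) B * real (min (card U) (card V))
                    * exp (- mu * (setdist L U V - v * \<bar>t\<bar>))"
    and G: "\<And>L. 1 \<le> L \<Longrightarrow> herm (Sp d L) (G L)"
    and A: "finite UA" "herm (cfgs d UA) aA" and o: "finite Uo" "herm (cfgs d Uo) ao"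
  shows "\<exists>K\<ge>0. \<forall>L\<ge>1. \<forall>t. (\<Sum>j\<in>lattice L. opnorm (Sp d L)
            (mcomm (Sp d L) (evol (Sp d L) (G L) (embed L (\<lambda>_. 0) UA aA) t) (embed L j Uo ao)))
          \<le> K * (1 + v * \<bar>t\<bar>) ^ CARD('n)"
proof -
  define a b where "a = entry_sum d UA aA" and "b = entry_sum d Uo ao"
  \<comment> \<open>The sum of the two prefactors to be merged: the trivial commutator bound and the
    Lieb-Robinson constant with norms and support size inserted.\<close>
  define Q where "Q = 2 * a * b + C * a * b * real (card UA)"
  define c where "c = (4 * (1 + 1 / (1 - exp (- (mu / real CARD('n)))))) ^ CARD('n)"
  have ab: "0 \<le> a" "0 \<le> b" by (simp_all add: a_def b_def entry_sum_nonneg)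
  then have Q: "0 \<le> Q" using C by (simp add: Q_def)
  have "exp (- (mu / real CARD('n))) < 1" using mu by simp
  then have c: "0 \<le> c" unfolding c_def by (intro zero_le_power) auto
  let ?K = "Q * (real (card UA) * (real (card Uo) * c))"
  have "(\<Sum>j\<in>lattice L. opnorm (Sp d L)
            (mcomm (Sp d L) (evol (Sp d L) (G L) (embed L (\<lambda>_. 0) UA aA) t) (embed L j Uo ao)))
          \<le> ?K * (1 + v * \<bar>t\<bar>) ^ CARD('n)" if L: "1 \<le> L" for L t
  proof -
    let ?S = "Sp d L" and ?T = "v * \<bar>t\<bar>"
    let ?A = "embed L (\<lambda>_. 0) UA aA"
    let ?U = "shift_site L (\<lambda>_. 0) ` UA"
    let ?g = "\<lambda>x z. exp (- mu * max 0 (real (tdist L x z) - ?T))"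
    have T: "0 \<le> ?T" using v by simp
    have UL: "?U \<subseteq> lattice L" using L by (auto intro: shift_site_lattice)
    have obA: "op_bound ?S ?A a" unfolding a_def by (intro op_bound_embed L A)
    have one: "opnorm ?S (mcomm ?S (evol ?S (G L) ?A t) (embed L j Uo ao))
        \<le> Q * (\<Sum>x\<in>?U. \<Sum>u\<in>Uo. ?g x (shift_site L j u))" for j
    proof -
      let ?B = "embed L j Uo ao"
      let ?V = "shift_site L j ` Uo"
      let ?X = "opnorm ?S (mcomm ?S (evol ?S (G L) ?A t) ?B)"
      have obB: "op_bound ?S ?B b" unfolding b_def by (intro op_bound_embed L o)
      have triv: "?X \<le> 2 * a * b"
        by (intro opnorm_le op_bound_mcomm op_bound_evol finite_Sp G L obA obB)
      have VL: "?V \<subseteq> lattice L" using L by (auto intro: shift_site_lattice)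
      have lr: "?X \<le> C * opnorm ?S ?A * opnorm ?S ?B * real (min (card ?U) (card ?V)) * exp (- mu * (setdist L ?U ?V - ?T))"
        by (intro LR L UL VL supported_in_embed herm_embed A o)
      show ?thesis
      \<comment> \<open>For an empty support the set distance is a minimum over the empty set; the
        factor 0 from the cardinalities settles this case.\<close>
      proof (cases "UA = {} \<or> Uo = {}")
        case True
        then show ?thesis using lr by auto
      next
        case False
        then obtain x y where xy: "x \<in> ?U" "y \<in> ?V" "setdist L ?U ?V = real (tdist L x y)"
          using setdist_attained[of ?U ?V L] A o by auto
        then obtain u where u: "u \<in> Uo" "y = shift_site L j u" by auto
        have nA: "0 \<le> opnorm ?S ?A" and nB: "0 \<le> opnorm ?S ?B"
          using op_bound_nonneg[OF op_bound_opnorm[OF finite_Sp]] by auto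
        have cU: "min (card ?U) (card ?V) \<le> card UA"
          using card_image_le[OF A(1), of "shift_site L (\<lambda>_. 0)"] by simp
        have "C * opnorm ?S ?A * opnorm ?S ?B * real (min (card ?U) (card ?V)) \<le> C * a * b * real (card UA)"
          using C ab nA nB cU opnorm_le[OF obA] opnorm_le[OF obB] by (intro mult_mono) auto
        then have "C * opnorm ?S ?A * opnorm ?S ?B * real (min (card ?U) (card ?V)) * exp (- mu * (real (tdist L x y) - ?T))
           \<le> C * a * b * real (card UA) * exp (- mu * (real (tdist L x y) - ?T))"
          by (intro mult_right_mono) auto
        then have "?X \<le> C * a * b * real (card UA) * exp (- mu * (real (tdist L x y) - ?T))"
          using lr unfolding xy(3) by linarith
        then have "?X \<le> Q * ?g x y"
          unfolding Q_def using triv ab C mu by (intro mult_exp_min_le) auto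
        also have "?g x y \<le> (\<Sum>u\<in>Uo. ?g x (shift_site L j u))"
          unfolding u(2) using o u by (intro member_le_sum) auto
        also have "\<dots> \<le> (\<Sum>x\<in>?U. \<Sum>u\<in>Uo. ?g x (shift_site L j u))"
          using A xy by (intro member_le_sum[where f = "\<lambda>x. \<Sum>u\<in>Uo. ?g x (shift_site L j u)"]) (auto intro: sum_nonneg)
        finally show ?thesis using Q by (simp add: mult_left_mono)
      qed
    qed
    have "(\<Sum>j\<in>lattice L. opnorm ?S (mcomm ?S (evol ?S (G L) ?A t) (embed L j Uo ao)))
        \<le> (\<Sum>j\<in>lattice L. Q * (\<Sum>x\<in>?U. \<Sum>u\<in>Uo. ?g x (shift_site L j u)))"
      by (intro sum_mono one)
    \<comment> \<open>Translations are summed innermost: for fixed x and u the sites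
      \<open>shift_site L j u\<close> are distinct, so the lattice sum applies.\<close>
    also have "\<dots> = Q * (\<Sum>x\<in>?U. \<Sum>u\<in>Uo. \<Sum>j\<in>lattice L. ?g x (shift_site L j u))"
      unfolding sum_distrib_left[symmetric]
      by (subst sum.swap, intro arg_cong2[where f = "(*)"] refl sum.cong, rule sum.swap)
    also have "\<dots> \<le> Q * (\<Sum>x\<in>?U. \<Sum>u\<in>Uo. c * (1 + ?T) ^ CARD('n))"
    proof (intro mult_left_mono sum_mono Q)
      fix x u assume "x \<in> ?U"
      then have x: "x \<in> lattice L" using UL by blast
      have "(\<Sum>j\<in>lattice L. ?g x (shift_site L j u)) \<le> (\<Sum>z\<in>lattice L. ?g x z)"
        by (intro sum_shift_le L) simp
      also have "\<dots> \<le> c * (1 + ?T) ^ CARD('n)"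
        unfolding c_def by (intro sum_lattice_exp mu T x)
      finally show "(\<Sum>j\<in>lattice L. ?g x (shift_site L j u)) \<le> c * (1 + ?T) ^ CARD('n)" .
    qed
    also have "\<dots> = Q * (real (card ?U) * (real (card Uo) * c)) * (1 + ?T) ^ CARD('n)"
      by simp
    also have "\<dots> \<le> ?K * (1 + ?T) ^ CARD('n)"
      using Q c T card_image_le[OF A(1), of "shift_site L (\<lambda>_. 0)"]
      by (intro mult_right_mono mult_left_mono) auto
    finally show ?thesis .
  qed
  moreover have "0 \<le> ?K" using Q c by simp
  ultimately show ?thesis by blast
qed

section \<open>Partial derivatives of the polynomial\<close>

definition close_in_box :: "nat \<Rightarrow> real \<Rightarrow> real \<Rightarrow> (nat \<Rightarrow> real) \<Rightarrow> (nat \<Rightarrow> real) \<Rightarrow> bool" where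
  "close_in_box m r e y y' \<longleftrightarrow> 0 \<le> e \<and> (\<forall>i<m. \<bar>y i\<bar> \<le> r \<and> \<bar>y' i\<bar> \<le> r \<and> \<bar>y i - y' i\<bar> \<le> e)"

text \<open>Boundedness and Lipschitz continuity are combined because the product rule needs bounds
  of the factors; polynomials then follow by closure under sums and products.\<close>

definition box_lipschitz :: "nat \<Rightarrow> real \<Rightarrow> ((nat \<Rightarrow> real) \<Rightarrow> real) \<Rightarrow> bool" where
  "box_lipschitz m r f \<longleftrightarrow> (\<exists>K\<ge>0. \<forall>y y' e. close_in_box m r e y y' \<longrightarrow> \<bar>f y\<bar> \<le> K \<and> \<bar>f y - f y'\<bar> \<le> K * e)"

lemma close_in_box_sym: "close_in_box m r e y y' \<Longrightarrow> close_in_box m r e y' y"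
  by (simp add: close_in_box_def abs_minus_commute)

lemma box_lipschitz_const: "box_lipschitz m r (\<lambda>_. k)"
  unfolding box_lipschitz_def by (intro exI[of _ "\<bar>k\<bar>"]) (auto simp: close_in_box_def)

lemma box_lipschitz_coord:
  assumes "i < m"
  shows "box_lipschitz m r (\<lambda>y. y i)"
  unfolding box_lipschitz_def
\<comment> \<open>Here 1 is the Lipschitz constant and |r| covers the bound.\<close>
proof (intro exI[of _ "max 1 \<bar>r\<bar>"] conjI allI impI)
  fix y y' e assume c: "close_in_box m r e y y'"
  then have "\<bar>y i - y' i\<bar> \<le> 1 * e" using assms by (simp add: close_in_box_def)
  also have "\<dots> \<le> max 1 \<bar>r\<bar> * e" using c by (intro mult_right_mono) (auto simp: close_in_box_def)
  finally show "\<bar>y i - y' i\<bar> \<le> max 1 \<bar>r\<bar> * e" .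
  have "\<bar>y i\<bar> \<le> r" using c assms by (simp add: close_in_box_def)
  then show "\<bar>y i\<bar> \<le> max 1 \<bar>r\<bar>" by simp
qed auto

lemma box_lipschitz_add:
  assumes "box_lipschitz m r f" "box_lipschitz m r g"
  shows "box_lipschitz m r (\<lambda>y. f y + g y)"
proof -
  obtain K where K: "0 \<le> K" "\<And>y y' e. close_in_box m r e y y' \<Longrightarrow> \<bar>f y\<bar> \<le> K \<and> \<bar>f y - f y'\<bar> \<le> K * e"
    using assms(1) unfolding box_lipschitz_def by blast
  obtain K' where K': "0 \<le> K'" "\<And>y y' e. close_in_box m r e y y' \<Longrightarrow> \<bar>g y\<bar> \<le> K' \<and> \<bar>g y - g y'\<bar> \<le> K' * e"
    using assms(2) unfolding box_lipschitz_def by blast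
  have "\<bar>f y + g y\<bar> \<le> K + K' \<and> \<bar>f y + g y - (f y' + g y')\<bar> \<le> (K + K') * e"
    if c: "close_in_box m r e y y'" for y y' e
    using K(2)[OF c] K'(2)[OF c] unfolding distrib_right by linarith
  then show ?thesis
    unfolding box_lipschitz_def using K(1) K'(1) by (intro exI[of _ "K + K'"]) auto
qed

lemma box_lipschitz_mult:
  assumes "box_lipschitz m r f" "box_lipschitz m r g"
  shows "box_lipschitz m r (\<lambda>y. f y * g y)"
proof -
  obtain K where K: "0 \<le> K" "\<And>y y' e. close_in_box m r e y y' \<Longrightarrow> \<bar>f y\<bar> \<le> K \<and> \<bar>f y - f y'\<bar> \<le> K * e"
    using assms(1) unfolding box_lipschitz_def by blast
  obtain K' where K': "0 \<le> K'" "\<And>y y' e. close_in_box m r e y y' \<Longrightarrow> \<bar>g y\<bar> \<le> K' \<and> \<bar>g y - g y'\<bar> \<le> K' * e"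
    using assms(2) unfolding box_lipschitz_def by blast
  have "\<bar>f y * g y\<bar> \<le> 2 * K * K' \<and> \<bar>f y * g y - f y' * g y'\<bar> \<le> 2 * K * K' * e"
    if c: "close_in_box m r e y y'" for y y' e
  proof -
    have e: "0 \<le> e" using c by (simp add: close_in_box_def)
    note f = K(2)[OF c] and g = K'(2)[OF c] and g' = K'(2)[OF close_in_box_sym[OF c]]
    have "\<bar>f y\<bar> * \<bar>g y\<bar> \<le> K * K'" using f g K by (intro mult_mono) auto
    then have 1: "\<bar>f y * g y\<bar> \<le> 2 * K * K'"
      using mult_nonneg_nonneg[OF K(1) K'(1)] by (simp add: abs_mult)
    \<comment> \<open>Each of the two terms costs at most \<open>K * K' * e\<close>; hence the
      factor 2 in the constant.\<close>
    have "f y * g y - f y' * g y' = f y * (g y - g y') + (f y - f y') * g y'"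
      by (simp add: algebra_simps)
    then have "\<bar>f y * g y - f y' * g y'\<bar> \<le> \<bar>f y\<bar> * \<bar>g y - g y'\<bar> + \<bar>f y - f y'\<bar> * \<bar>g y'\<bar>"
      by (simp only: abs_mult[symmetric] abs_triangle_ineq)
    also have "\<dots> \<le> K * (K' * e) + (K * e) * K'"
      using f g g' K K' e by (intro add_mono mult_mono) auto
    finally show ?thesis using 1 by (simp add: mult_ac)
  qed
  then show ?thesis
    unfolding box_lipschitz_def using K(1) K'(1) by (intro exI[of _ "2 * K * K'"]) auto
qed

lemma box_lipschitz_sum:
  assumes "finite W" "\<And>w. w \<in> W \<Longrightarrow> box_lipschitz m r (f w)"
  shows "box_lipschitz m r (\<lambda>y. \<Sum>w\<in>W. f w y)"
  using assms by (induction W) (auto intro: box_lipschitz_const box_lipschitz_add)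

lemma box_lipschitz_prod_list:
  "set w \<subseteq> {..<m} \<Longrightarrow> box_lipschitz m r (\<lambda>y. prod_list (map y w))"
  by (induction w) (auto intro: box_lipschitz_const box_lipschitz_mult box_lipschitz_coord)

lemma box_lipschitz_dword:
  "set w \<subseteq> {..<m} \<Longrightarrow> box_lipschitz m r (dword i w)"
proof (induction w)
  case Nil
  then show ?case using box_lipschitz_const[of m r 0] by simp
next
  case (Cons a w)
  then have "box_lipschitz m r (\<lambda>y. (if i = a then prod_list (map y w) else 0) + y a * dword i w y)"
    by (cases "i = a")
      (auto intro!: box_lipschitz_add box_lipschitz_mult box_lipschitz_prod_list box_lipschitz_coord box_lipschitz_const)
  then show ?case by simp
qed

text \<open>Ties the formal derivative from the commutator expansion to the analytic one in
  \<open>pdiff\<close>.\<close>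

lemma DERIV_prod_list:
  fixes y :: "nat \<Rightarrow> real"
  shows "((\<lambda>t. prod_list (map (y(i := t)) w)) has_field_derivative dword i w y) (at (y i))"
proof (induction w)
  case Nil
  then show ?case by simp
next
  case (Cons a w)
  have "((\<lambda>t. (y(i := t)) a) has_field_derivative (if i = a then 1 else 0)) (at (y i))"
    by auto
  from DERIV_mult'[OF this Cons.IH] show ?case
    by (auto simp: algebra_simps)
qed

lemma pdiff_dword:
  assumes "finite {w. c w \<noteq> 0}"
  shows "pdiff c i y = (\<Sum>w\<in>{w. c w \<noteq> 0}. c w * dword i w y)"
  unfolding pdiff_def cev_def
  by (intro DERIV_imp_deriv DERIV_sum DERIV_cmult DERIV_prod_list)

lemma box_lipschitz_pdiff:
  assumes "finite {w. c w \<noteq> 0}" "\<And>w. c w \<noteq> 0 \<Longrightarrow> set w \<subseteq> {..<m}"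
  shows "box_lipschitz m r (pdiff c i)"
proof -
  have "box_lipschitz m r (\<lambda>y. \<Sum>w\<in>{w. c w \<noteq> 0}. c w * dword i w y)"
    using assms by (intro box_lipschitz_sum box_lipschitz_mult box_lipschitz_const box_lipschitz_dword) auto
  moreover have "pdiff c i = (\<lambda>y. \<Sum>w\<in>{w. c w \<noteq> 0}. c w * dword i w y)"
    by (rule ext) (rule pdiff_dword[OF assms(1)])
  ultimately show ?thesis by (simp only:)
qed

section \<open>Replacing the polynomial by its linearization\<close>

lemma op_bound_xhat:
  fixes U :: "('n::finite \<Rightarrow> int) set"
  assumes "1 \<le> L" "finite U" "herm (cfgs d U) a"
  shows "op_bound (Sp d L) (xhat L U a) (entry_sum d U a)"
proof -
  have "op_bound (Sp d L) (Xop L U a) (\<Sum>j\<in>(lattice L :: ('n \<Rightarrow> nat) set). entry_sum d U a)"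
    unfolding Xop_def using assms by (intro op_bound_sum finite_lattice op_bound_embed)
  from op_bound_msc[OF this, of "complex_of_real (1 / real L ^ CARD('n))"] show ?thesis
    unfolding xhat_def norm_of_real using assms(1) by (simp add: card_lattice)
qed

lemma herm_Xop:
  assumes "1 \<le> L" "herm (cfgs d U) a"
  shows "herm (Sp d L) (Xop L U a)"
  unfolding herm_def[of "Sp d L"] Xop_def
  by (auto simp: herm_cnj[OF herm_embed[OF assms]])

lemma herm_xhat:
  assumes "1 \<le> L" "herm (cfgs d U) a"
  shows "herm (Sp d L) (xhat L U a)"
  unfolding herm_def[of "Sp d L"] xhat_def msc_def
  by (auto simp: herm_cnj[OF herm_Xop[OF assms]])

lemma herm_GamN:
  assumes "1 \<le> L" "\<And>i. i < m \<Longrightarrow> herm (cfgs d (Uo i)) (ao i)"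
  shows "herm (Sp d L) (GamN m Pv Uo ao L)"
  unfolding herm_def[of "Sp d L"] GamN_def
  using herm_cnj[OF herm_Xop[OF assms(1) assms(2)]] by auto

text \<open>The source of the factor 1/N that compensates the extensive generator.\<close>

lemma op_bound_mcomm_xhat:
  fixes U :: "('n::finite \<Rightarrow> int) set"
  assumes "(\<Sum>j\<in>lattice L. opnorm (Sp d L) (mcomm (Sp d L) B (embed L j U a))) \<le> k"
  shows "op_bound (Sp d L) (mcomm (Sp d L) B (xhat L U a)) (k / real L ^ CARD('n))"
proof -
  have "op_bound (Sp d L) (mcomm (Sp d L) B (Xop L U a)) k"
    unfolding Xop_def mcomm_sum
    by (rule op_bound_mono[OF op_bound_sum assms]) (auto intro: finite_lattice op_bound_opnorm finite_Sp)
  from op_bound_msc[OF this, of "complex_of_real (1 / real L ^ CARD('n))"] show ?thesis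
    unfolding xhat_def mcomm_msc norm_of_real by simp
qed

lemma powr_minus_half_power: "1 \<le> L \<Longrightarrow> (real L powr (-1/2)) ^ n = 1 / sqrt (real L ^ n)"
proof -
  assume "1 \<le> L"
  then have "real L powr (-1/2) = 1 / sqrt (real L)"
    by (simp add: powr_minus_divide powr_half_sqrt)
  then show ?thesis by (simp add: power_divide real_sqrt_power)
qed

text \<open>Sums in place of maxima combine the constants and the thresholds, and also cover m =
  0.\<close>

lemma finite_family_bound:
  fixes f :: "nat \<Rightarrow> nat \<Rightarrow> real" and g :: "nat \<Rightarrow> real"
  assumes "\<forall>i<m. \<exists>K L0. \<forall>L\<ge>L0. f i L \<le> K * g L" "\<And>L. 0 \<le> g L"
  obtains K L0 where "0 \<le> K" "\<And>L i. L0 \<le> L \<Longrightarrow> i < m \<Longrightarrow> f i L \<le> K * g L"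
proof -
  obtain K L0 where K: "\<And>i L. i < m \<Longrightarrow> L0 i \<le> L \<Longrightarrow> f i L \<le> K i * g L"
    using assms(1) by metis
  have "f i L \<le> (\<Sum>i<m. \<bar>K i\<bar>) * g L" if L: "(\<Sum>i<m. L0 i) \<le> L" and i: "i < m" for i L
  proof -
    have "L0 i \<le> (\<Sum>i<m. L0 i)" using i by (intro member_le_sum) auto
    then have "f i L \<le> K i * g L" using L i by (intro K) auto
    also have "\<dots> \<le> (\<Sum>i<m. \<bar>K i\<bar>) * g L"
    proof (intro mult_right_mono assms)
      have "\<bar>K i\<bar> \<le> (\<Sum>i<m. \<bar>K i\<bar>)" using i by (intro member_le_sum) auto
      then show "K i \<le> (\<Sum>i<m. \<bar>K i\<bar>)" by simp
    qed
    finally show ?thesis .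
  qed
  then show ?thesis by (intro that[of "\<Sum>i<m. \<bar>K i\<bar>" "\<Sum>i<m. L0 i"]) (auto intro: sum_nonneg)
qed

text \<open>Stationarity: the trace of [B, H] R equals that of B [H, R], and R commutes with H as a
  function of it.\<close>

lemma mtr_mcomm_mexp:
  assumes "finite S" "R = msc k (mexp S (msc z H))"
  shows "mtr S (mmul S (mcomm S B H) R) = 0"
proof -
  have "mtr S (mmul S (mmul S H B) R) = mtr S (mmul S B (mmul S R H))"
    by (simp add: mmul_assoc mtr_cyclic[of S H])
  also have "\<dots> = mtr S (mmul S B (mmul S H R))"
    unfolding assms(2) mmul_msc_left mmul_msc_right mtr_msc
    using assms(1) by (intro arg_cong2[where f = "(*)"] refl mtr_mmul_cong) (auto simp: mexp_commute)
  finally show ?thesis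
    unfolding mcomm_def mmul_msub_left mtr_msub by (simp add: mmul_assoc)
qed

lemma gibbs_rhoN:
  fixes L :: nat and Uo :: "nat \<Rightarrow> ('n::finite \<Rightarrow> int) set"
  assumes "1 \<le> d" "herm (Sp d L) (etaN d c Uo ao L)"
  shows "\<exists>F Z. gibbs_root (Sp d L) F Z (rhoN d c Uo ao L)"
  using gibbs_root_mexp[OF finite_Sp Sp_nonempty[OF assms(1)] assms(2), of "- (real L ^ CARD('n))"]
  unfolding rhoN_def Let_def by (simp only: of_real_minus)

text \<open>Commutators with densities are of size k/N, deviations of size sqrt (V/N), coefficient
  errors of size E/sqrt N. The factor N in the generator leaves k/sqrt N.\<close>

lemma mtr_mcomm_GamN_bound:
  fixes Uo :: "nat \<Rightarrow> ('n::finite \<Rightarrow> int) set" and L :: nat and k V E r :: real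
  assumes d: "1 \<le> d" and L: "1 \<le> L"
    and obs: "\<And>i. i < m \<Longrightarrow> finite (Uo i)" "\<And>i. i < m \<Longrightarrow> herm (cfgs d (Uo i)) (ao i)"
    and eta_fin: "finite {w. c w \<noteq> 0}"
    and eta_vars: "\<And>w. c w \<noteq> 0 \<Longrightarrow> set w \<subseteq> {..<m}"
    and eta_sa: "herm (Sp d L) (etaN d c Uo ao L)"
    and r: "1 \<le> r" "\<And>i. i < m \<Longrightarrow> entry_sum d (Uo i) (ao i) \<le> r"
    and V: "0 \<le> V" "\<And>i. i < m \<Longrightarrow> cmod (varN d c Uo ao L i) \<le> V * (1 / real L ^ CARD('n))"
    and E: "\<And>i. i < m \<Longrightarrow> \<bar>Pv i - pdiff c i (xN d c Uo ao L)\<bar> \<le> E * (1 / sqrt (real L ^ CARD('n)))"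
    and k: "0 \<le> k" "\<And>i. i < m \<Longrightarrow> (\<Sum>j\<in>lattice L. opnorm (Sp d L) (mcomm (Sp d L) B (embed L j (Uo i) (ao i)))) \<le> k"
  shows "cmod (mtr (Sp d L) (mmul (Sp d L) (mcomm (Sp d L) B (GamN m Pv Uo ao L)) (rhoN d c Uo ao L)))
      \<le> (real m * E + sqrt V * (\<Sum>w\<in>{w. c w \<noteq> 0}. \<bar>c w\<bar> * word_err r w)) * k * (1 / sqrt (real L ^ CARD('n)))"
proof -
  let ?S = "Sp d L" and ?N = "real L ^ CARD('n)" and ?R = "rhoN d c Uo ao L"
  let ?x = "\<lambda>i. xhat L (Uo i) (ao i)" and ?y = "xN d c Uo ao L"
  let ?Ce = "\<Sum>w\<in>{w. c w \<noteq> 0}. \<bar>c w\<bar> * word_err r w"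
  have N: "?N > 0" using L by simp
  obtain F Z where root: "gibbs_root ?S F Z ?R"
    using gibbs_rhoN[OF d eta_sa] by blast
  have xb: "op_bound ?S (?x i) r" if "i < m" for i
    using op_bound_mono[OF op_bound_xhat[OF L obs(1)[OF that] obs(2)[OF that]] r(2)[OF that]] .
  interpret gibbs_observables ?S F ?R Z ?x ?y m r "sqrt (V * (1 / ?N))"
  proof
    show "\<bar>?y i\<bar> \<le> r" if "i < m" for i
      unfolding xN_def using gibbs_trace_le[OF root xb[OF that]] abs_Re_le_cmod order.trans by blast
    show "cmod (mtr ?S (mmul ?S (mmul ?S (msub (?x i) (msc (?y i) mid)) (msub (?x i) (msc (?y i) mid))) ?R))
        \<le> (sqrt (V * (1 / ?N)))\<^sup>2" if "i < m" for i
      using V(2)[OF that] V(1) N unfolding varN_def Let_def by simp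
  qed (use root r V(1) N xb herm_xhat[OF L obs(2)] in auto)
  define t where "t i = mtr ?S (mmul ?S (mcomm ?S B (?x i)) ?R)" for i
  have cb: "op_bound ?S (mcomm ?S B (?x i)) (k / ?N)" if "i < m" for i
    using k(2)[OF that] by (rule op_bound_mcomm_xhat)
  have t: "cmod (t i) \<le> k / ?N" if "i < m" for i
    unfolding t_def by (rule gibbs_trace_le[OF root cb[OF that]])
  have "cmod (mtr ?S (mmul ?S (mcomm ?S B (ncev ?S c ?x)) ?R)
            - (\<Sum>i<m. (\<Sum>w\<in>{w. c w \<noteq> 0}. c w * dword i w ?y) * mtr ?S (mmul ?S (mcomm ?S B (?x i)) ?R)))
         \<le> k / ?N * ?Ce * sqrt (V * (1 / ?N))"
    using k(1) N eta_vars by (intro mtr_mcomm_ncev cb) auto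
  \<comment> \<open>Stationarity removes the polynomial itself, so its linearization is as small as
    the replacement error.\<close>
  moreover have "mtr ?S (mmul ?S (mcomm ?S B (ncev ?S c ?x)) ?R) = 0"
    by (rule mtr_mcomm_mexp[OF finite_Sp]) (simp add: rhoN_def Let_def etaN_def)
  ultimately have 1: "cmod (\<Sum>i<m. pdiff c i ?y * t i) \<le> k / ?N * ?Ce * sqrt (V * (1 / ?N))"
    unfolding pdiff_dword[OF eta_fin] t_def by simp
  have "cmod (\<Sum>i<m. complex_of_real (Pv i - pdiff c i ?y) * t i) \<le> (\<Sum>i<m. E * (1 / sqrt ?N) * (k / ?N))"
    by (rule sum_norm_le) (unfold norm_mult norm_of_real, intro mult_mono' E t, auto)
  then have 2: "cmod (\<Sum>i<m. complex_of_real (Pv i - pdiff c i ?y) * t i) \<le> real m * (E * (1 / sqrt ?N) * (k / ?N))"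
    by simp
  have "GamN m Pv Uo ao L = (\<lambda>\<sigma> \<tau>. \<Sum>i<m. msc (Pv i * ?N) (?x i) \<sigma> \<tau>)"
    using L by (simp add: GamN_def msc_def xhat_def)
  then have "mtr ?S (mmul ?S (mcomm ?S B (GamN m Pv Uo ao L)) ?R) = (\<Sum>i<m. Pv i * ?N * t i)"
    by (simp only: mcomm_sum mtr_mmul_sum mcomm_msc mmul_msc_left mtr_msc t_def of_real_mult)
  \<comment> \<open>Each \<open>Pv i\<close> is split into the partial derivative at the mean
    values, covered by estimate 1, and the deviation from it, covered by estimate 2.\<close>
  also have "\<dots> = ?N * ((\<Sum>i<m. complex_of_real (Pv i - pdiff c i ?y) * t i) + (\<Sum>i<m. pdiff c i ?y * t i))"
    by (simp add: sum.distrib[symmetric] sum_distrib_left algebra_simps)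
  finally have "cmod (mtr ?S (mmul ?S (mcomm ?S B (GamN m Pv Uo ao L)) ?R))
      = ?N * cmod ((\<Sum>i<m. complex_of_real (Pv i - pdiff c i ?y) * t i) + (\<Sum>i<m. pdiff c i ?y * t i))"
    using N by (simp only: norm_mult norm_of_real abs_of_pos)
  also have "\<dots> \<le> ?N * (real m * (E * (1 / sqrt ?N) * (k / ?N)) + k / ?N * ?Ce * sqrt (V * (1 / ?N)))"
    using N by (intro mult_left_mono norm_triangle_mono 1 2) auto
  also have "\<dots> = (real m * E + sqrt V * ?Ce) * k * (1 / sqrt ?N)"
    using N by (simp add: real_sqrt_mult real_sqrt_divide field_simps)
  finally show ?thesis .
qed

section \<open>A bound uniform in \<tau>, and its two regimes\<close>

theorem theorem3:
  fixes d m :: nat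
    and Uo :: "nat \<Rightarrow> ('n::finite \<Rightarrow> int) set" and ao :: "nat \<Rightarrow> ('n \<Rightarrow> int) op"
    and c :: "nat list \<Rightarrow> real"
    and xlim Pv :: "nat \<Rightarrow> real"
    and C mu v :: real
    and UA :: "('n \<Rightarrow> int) set" and aA :: "('n \<Rightarrow> int) op"
  assumes d_pos: "d \<ge> 1"
    and obs: "\<forall>i<m. finite (Uo i) \<and> herm (cfgs d (Uo i)) (ao i)"
    and eta_fin: "finite {w. c w \<noteq> 0}"
    and eta_vars: "\<forall>w. c w \<noteq> 0 \<longrightarrow> set w \<subseteq> {..<m}"
    and eta_sa: "\<forall>L\<ge>1. herm (Sp d L) (etaN d c Uo ao L)"
    and x_lim: "\<forall>i<m. (\<lambda>L. xN d c Uo ao L i) \<longlonglongrightarrow> xlim i"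
    and Pi_lim: "\<forall>i<m. (\<lambda>L. pdiff c i (xN d c Uo ao L)) \<longlonglongrightarrow> Pv i"
    and C_pos: "C > 0" and mu_pos: "mu > 0" and v_pos: "v > 0"
    and LR: "\<forall>L\<ge>1. \<forall>U V A B. U \<subseteq> lattice L \<and> V \<subseteq> lattice L
               \<and> supported_in d L U A \<and> herm (Sp d L) A
               \<and> supported_in d L V B \<and> herm (Sp d L) B \<longrightarrow>
               (\<forall>t::real. opnorm (Sp d L) (mcomm (Sp d L) (evol (Sp d L) (GamN m Pv Uo ao L) A t) B)
                  \<le> C * opnorm (Sp d L) A * opnorm (Sp d L) B * real (min (card U) (card V))
                    * exp (- mu * (setdist L U V - v * \<bar>t\<bar>)))"
    and fluct: "\<forall>i<m. \<exists>K L0. \<forall>L\<ge>L0. cmod (varN d c Uo ao L i) \<le> K / real L ^ CARD('n)"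
    and conv: "\<forall>i<m. \<exists>K L0. \<forall>L\<ge>L0.
                 \<bar>xN d c Uo ao L i - xlim i\<bar> \<le> K * (real L ^ CARD('n)) powr (-1/2)"
    and A_obs: "finite UA" "herm (cfgs d UA) aA"
  shows "(\<forall>K>0. \<exists>K' L0. \<forall>L\<ge>L0. \<forall>\<tau>. v * \<bar>\<tau>\<bar> \<le> K * ln (real L) \<longrightarrow>
            (\<exists>D. ((\<lambda>t. mtr (Sp d L) (mmul (Sp d L) (evol (Sp d L) (GamN m Pv Uo ao L)
                       (embed L (\<lambda>_. 0) UA aA) t) (rhoN d c Uo ao L))) has_vector_derivative D) (at \<tau>)
                 \<and> cmod D \<le> K' * (real L powr (-1/2) * ln (real L)) ^ CARD('n)))
       \<and> (\<exists>\<epsilon>>0. \<exists>K' L0. \<forall>L\<ge>L0. \<forall>\<tau>. ln (real L) \<le> v * \<bar>\<tau>\<bar> \<and> v * \<bar>\<tau>\<bar> \<le> \<epsilon> * real L \<longrightarrow>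
            (\<exists>D. ((\<lambda>t. mtr (Sp d L) (mmul (Sp d L) (evol (Sp d L) (GamN m Pv Uo ao L)
                       (embed L (\<lambda>_. 0) UA aA) t) (rhoN d c Uo ao L))) has_vector_derivative D) (at \<tau>)
                 \<and> cmod D \<le> K' * (real L powr (-1/2) * \<bar>\<tau>\<bar>) ^ CARD('n)))"
proof -
  let ?n = "CARD('n)"
  let ?s = "\<lambda>L. 1 / sqrt (real L ^ ?n)"
  let ?f = "\<lambda>L t. mtr (Sp d L) (mmul (Sp d L) (evol (Sp d L) (GamN m Pv Uo ao L)
                       (embed L (\<lambda>_. 0) UA aA) t) (rhoN d c Uo ao L))"
  have obs1: "\<And>i. i < m \<Longrightarrow> finite (Uo i)" and obs2: "\<And>i. i < m \<Longrightarrow> herm (cfgs d (Uo i)) (ao i)"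
    using obs by auto
  have vars: "\<And>w. c w \<noteq> 0 \<Longrightarrow> set w \<subseteq> {..<m}" using eta_vars by blast
  have G: "herm (Sp d L) (GamN m Pv Uo ao L)" if "1 \<le> L" for L
    by (rule herm_GamN[OF that obs2])

  have "\<forall>i<m. \<exists>K L0. \<forall>L\<ge>L0. cmod (varN d c Uo ao L i) \<le> K * (1 / real L ^ ?n)"
    using fluct by simp
  then obtain V LV where V0: "0 \<le> V"
    and V: "\<And>L i. LV \<le> L \<Longrightarrow> i < m \<Longrightarrow> cmod (varN d c Uo ao L i) \<le> V * (1 / real L ^ ?n)"
    by (rule finite_family_bound) auto
  obtain X LX where X0: "0 \<le> X"
    and X: "\<And>L i. LX \<le> L \<Longrightarrow> i < m \<Longrightarrow> \<bar>xN d c Uo ao L i - xlim i\<bar> \<le> X * (real L ^ ?n) powr (-1/2)"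
    by (rule finite_family_bound[OF conv]) auto

  \<comment> \<open>One bound for all densities and means; the summand 1 secures r \<ge> 1.\<close>
  define r where "r = 1 + (\<Sum>i<m. entry_sum d (Uo i) (ao i))"
  have r1: "1 \<le> r" by (simp add: r_def sum_nonneg entry_sum_nonneg)
  have r: "entry_sum d (Uo i) (ao i) \<le> r" if "i < m" for i
  proof -
    have "entry_sum d (Uo i) (ao i) \<le> (\<Sum>i<m. entry_sum d (Uo i) (ao i))"
      using that by (intro member_le_sum) (auto simp: entry_sum_nonneg)
    then show ?thesis by (simp add: r_def)
  qed
  have x_le: "\<bar>xN d c Uo ao L i\<bar> \<le> r" if L: "1 \<le> L" and i: "i < m" for L i
  proof -
    obtain F Z where root: "gibbs_root (Sp d L) F Z (rhoN d c Uo ao L)"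
      using gibbs_rhoN[OF d_pos, of L c Uo ao] eta_sa L by blast
    have "op_bound (Sp d L) (xhat L (Uo i) (ao i)) r"
      using op_bound_mono[OF op_bound_xhat[OF L obs1[OF i] obs2[OF i]] r[OF i]] .
    from gibbs_trace_le[OF root this] show ?thesis
      unfolding xN_def using abs_Re_le_cmod order.trans by blast
  qed
  \<comment> \<open>The limits stay in the closed box, so the Lipschitz estimate can compare them
    with the means.\<close>
  have xlim_le: "\<bar>xlim i\<bar> \<le> r" if "i < m" for i
  proof (rule LIMSEQ_le_const2)
    show "(\<lambda>L. \<bar>xN d c Uo ao L i\<bar>) \<longlonglongrightarrow> \<bar>xlim i\<bar>"
      using x_lim that by (intro tendsto_rabs) blast
    show "\<exists>M. \<forall>L\<ge>M. \<bar>xN d c Uo ao L i\<bar> \<le> r"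
      using x_le that by blast
  qed

  \<comment> \<open>Uniqueness of limits first identifies \<open>Pv i\<close> with the derivative at
    \<open>xlim\<close>; the same Lipschitz constant then carries the rate of the means over to the
    coefficients.\<close>
  have Pi: "\<exists>K L0. \<forall>L\<ge>L0. \<bar>Pv i - pdiff c i (xN d c Uo ao L)\<bar> \<le> K * ?s L" if i: "i < m" for i
  proof -
    obtain K where K: "0 \<le> K"
      "\<And>y y' e. close_in_box m r e y y' \<Longrightarrow> \<bar>pdiff c i y - pdiff c i y'\<bar> \<le> K * e"
      using box_lipschitz_pdiff[OF eta_fin vars, where r = r and i = i] unfolding box_lipschitz_def by blast
    let ?e = "\<lambda>L. \<Sum>j<m. \<bar>xN d c Uo ao L j - xlim j\<bar>"
    have "?e \<longlonglongrightarrow> (\<Sum>j<m. \<bar>xlim j - xlim j\<bar>)"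
      using x_lim by (intro tendsto_sum tendsto_rabs tendsto_diff tendsto_const) auto
    then have e: "(\<lambda>L. K * ?e L) \<longlonglongrightarrow> 0"
      using tendsto_mult_right_zero by simp
    have "norm (pdiff c i (xN d c Uo ao L) - pdiff c i xlim) \<le> K * ?e L" if "1 \<le> L" for L
    proof -
      have "close_in_box m r (?e L) (xN d c Uo ao L) xlim"
        unfolding close_in_box_def using x_le[OF that] xlim_le
        by (auto intro!: sum_nonneg member_le_sum[where f = "\<lambda>j. \<bar>xN d c Uo ao L j - xlim j\<bar>"])
      then show ?thesis using K(2) by simp
    qed
    then have "(\<lambda>L. pdiff c i (xN d c Uo ao L) - pdiff c i xlim) \<longlonglongrightarrow> 0"
      by (intro Lim_null_comparison[OF _ e] eventually_sequentiallyI[of 1])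
    then have "(\<lambda>L. pdiff c i (xN d c Uo ao L)) \<longlonglongrightarrow> pdiff c i xlim"
      by (simp add: LIM_zero_iff)
    then have P: "Pv i = pdiff c i xlim"
      using Pi_lim i LIMSEQ_unique by blast
    have "\<bar>Pv i - pdiff c i (xN d c Uo ao L)\<bar> \<le> K * X * ?s L" if L: "max 1 LX \<le> L" for L
    proof -
      have "(real L ^ ?n) powr (-1/2) = ?s L"
        using L by (simp add: powr_minus_divide powr_half_sqrt)
      then have "close_in_box m r (X * ?s L) (xN d c Uo ao L) xlim"
        unfolding close_in_box_def using x_le[of L] xlim_le X[of L] X0 L by simp
      from K(2)[OF this] show ?thesis unfolding P by (simp add: abs_minus_commute)
    qed
    then show ?thesis by blast
  qed
  from Pi have "\<forall>i<m. \<exists>K L0. \<forall>L\<ge>L0. \<bar>Pv i - pdiff c i (xN d c Uo ao L)\<bar> \<le> K * ?s L"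
    by blast
  then obtain E LE where E0: "0 \<le> E"
    and E: "\<And>L i. LE \<le> L \<Longrightarrow> i < m \<Longrightarrow> \<bar>Pv i - pdiff c i (xN d c Uo ao L)\<bar> \<le> E * ?s L"
    by (rule finite_family_bound) auto

  have "\<exists>K\<ge>0. \<forall>L\<ge>1. \<forall>t. (\<Sum>j\<in>lattice L. opnorm (Sp d L)
            (mcomm (Sp d L) (evol (Sp d L) (GamN m Pv Uo ao L) (embed L (\<lambda>_. 0) UA aA) t) (embed L j (Uo i) (ao i))))
          \<le> K * (1 + v * \<bar>t\<bar>) ^ ?n" if "i < m" for i
    by (rule sum_commutators_bound[OF C_pos mu_pos v_pos _ G A_obs obs1[OF that] obs2[OF that]])
      (use LR in blast)+
  then obtain k where k0: "\<And>i. i < m \<Longrightarrow> 0 \<le> k i" and k: "\<And>i L t. i < m \<Longrightarrow> 1 \<le> L \<Longrightarrow> (\<Sum>j\<in>lattice L. opnorm (Sp d L)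
            (mcomm (Sp d L) (evol (Sp d L) (GamN m Pv Uo ao L) (embed L (\<lambda>_. 0) UA aA) t) (embed L j (Uo i) (ao i))))
          \<le> k i * (1 + v * \<bar>t\<bar>) ^ ?n"
    by metis
  define q where "q = (\<Sum>i<m. k i)"
  have q0: "0 \<le> q" unfolding q_def using k0 by (intro sum_nonneg) auto
  have kq: "k i \<le> q" if "i < m" for i
    unfolding q_def using that k0 by (intro member_le_sum) auto

  define W where "W = (\<Sum>w\<in>{w. c w \<noteq> 0}. \<bar>c w\<bar> * word_err r w)"
  have W0: "0 \<le> W" using r1 by (auto simp: W_def intro!: sum_nonneg mult_nonneg_nonneg word_err_nonneg)
  define H where "H = (real m * E + sqrt V * W) * q"
  have H0: "0 \<le> H" using E0 V0 W0 q0 by (simp add: H_def)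
  \<comment> \<open>The value 3 exceeds e, so ln L \<ge> 1 from \<open>L1\<close> on.\<close>
  define L1 where "L1 = max 3 (max LV LE)"
  have key: "\<exists>D. (?f L has_vector_derivative D) (at \<tau>) \<and>
      cmod D \<le> H * (1 + v * \<bar>\<tau>\<bar>) ^ ?n * (real L powr (-1/2)) ^ ?n" if L: "L1 \<le> L" for L \<tau>
  proof -
    let ?B = "evol (Sp d L) (GamN m Pv Uo ao L) (embed L (\<lambda>_. 0) UA aA) \<tau>"
    let ?D = "- \<i> * mtr (Sp d L) (mmul (Sp d L) (mcomm (Sp d L) ?B (GamN m Pv Uo ao L)) (rhoN d c Uo ao L))"
    have L': "1 \<le> L" "LV \<le> L" "LE \<le> L" using L by (auto simp: L1_def)
    have T: "0 \<le> (1 + v * \<bar>\<tau>\<bar>) ^ ?n" using v_pos by simp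
    have "(\<Sum>j\<in>lattice L. opnorm (Sp d L) (mcomm (Sp d L) ?B (embed L j (Uo i) (ao i)))) \<le> q * (1 + v * \<bar>\<tau>\<bar>) ^ ?n"
      if "i < m" for i
      using k[OF that L'(1), of \<tau>] mult_right_mono[OF kq[OF that] T] by linarith
    then have "cmod ?D \<le> (real m * E + sqrt V * W) * (q * (1 + v * \<bar>\<tau>\<bar>) ^ ?n) * ?s L"
      unfolding W_def norm_mult norm_minus_cancel norm_ii mult_1_left
      by (intro mtr_mcomm_GamN_bound d_pos L' obs1 obs2 eta_fin vars r1 r V0 V E mult_nonneg_nonneg q0 T)
        (use eta_sa L' in auto)
    then have "cmod ?D \<le> H * (1 + v * \<bar>\<tau>\<bar>) ^ ?n * (real L powr (-1/2)) ^ ?n"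
      unfolding H_def powr_minus_half_power[OF L'(1)] by (simp only: mult.assoc)
    moreover have "(?f L has_vector_derivative ?D) (at \<tau>)"
      by (rule has_vector_derivative_mtr_evol[OF finite_Sp])
    ultimately show ?thesis by blast
  qed
  have ln1: "1 \<le> ln (real L)" if "L1 \<le> L" for L
  proof -
    have "exp 1 \<le> real L" using exp_le that by (simp add: L1_def)
    then show ?thesis using that by (simp add: L1_def ln_ge_iff)
  qed
  \<comment> \<open>Here a stands for ln L or |\<tau>|, and b for the constant with which a
    dominates the light-cone scale 1 + v |\<tau>|.\<close>
  have regime: "\<exists>D. (?f L has_vector_derivative D) (at \<tau>) \<and> cmod D \<le> H * b ^ ?n * (real L powr (-1/2) * a) ^ ?n"
    if L: "L1 \<le> L" and T: "1 + v * \<bar>\<tau>\<bar> \<le> b * a" for L \<tau> a b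
  proof -
    obtain D where D: "(?f L has_vector_derivative D) (at \<tau>)"
      "cmod D \<le> H * (1 + v * \<bar>\<tau>\<bar>) ^ ?n * (real L powr (-1/2)) ^ ?n"
      using key[OF L] by blast
    note D(2)
    also have "H * (1 + v * \<bar>\<tau>\<bar>) ^ ?n * (real L powr (-1/2)) ^ ?n \<le> H * (b * a) ^ ?n * (real L powr (-1/2)) ^ ?n"
      using T H0 v_pos by (intro mult_right_mono mult_left_mono power_mono) auto
    also have "\<dots> = H * b ^ ?n * (real L powr (-1/2) * a) ^ ?n"
      by (simp only: power_mult_distrib mult_ac)
    finally show ?thesis using D(1) by blast
  qed
  show ?thesis
  proof (intro conjI allI impI)
    fix K :: real assume "K > 0"
    have "1 + v * \<bar>\<tau>\<bar> \<le> (1 + K) * ln (real L)" if "L1 \<le> L" "v * \<bar>\<tau>\<bar> \<le> K * ln (real L)" for L \<tau>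
      using ln1[OF that(1)] that(2) by (simp add: distrib_right)
    then show "\<exists>K' L0. \<forall>L\<ge>L0. \<forall>\<tau>. v * \<bar>\<tau>\<bar> \<le> K * ln (real L) \<longrightarrow>
            (\<exists>D. (?f L has_vector_derivative D) (at \<tau>)
                 \<and> cmod D \<le> K' * (real L powr (-1/2) * ln (real L)) ^ ?n)"
      by (intro exI[of _ "H * (1 + K) ^ ?n"] exI[of _ L1] allI impI regime)
  next
    \<comment> \<open>Since 1 \<le> ln L \<le> v |\<tau>|, the summand 1 at most doubles v
      |\<tau>|.\<close>
    have "1 + v * \<bar>\<tau>\<bar> \<le> (2 * v) * \<bar>\<tau>\<bar>" if "L1 \<le> L" "ln (real L) \<le> v * \<bar>\<tau>\<bar> \<and> v * \<bar>\<tau>\<bar> \<le> 1 * real L" for L \<tau>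
      using ln1[OF that(1)] that(2) by simp
    then show "\<exists>\<epsilon>>0. \<exists>K' L0. \<forall>L\<ge>L0. \<forall>\<tau>. ln (real L) \<le> v * \<bar>\<tau>\<bar> \<and> v * \<bar>\<tau>\<bar> \<le> \<epsilon> * real L \<longrightarrow>
            (\<exists>D. (?f L has_vector_derivative D) (at \<tau>)
                 \<and> cmod D \<le> K' * (real L powr (-1/2) * \<bar>\<tau>\<bar>) ^ ?n)"
      by (intro exI[of _ 1] exI[of _ "H * (2 * v) ^ ?n"] exI[of _ L1] conjI allI impI regime zero_less_one)
  qed
qed

end
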